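(* Let $n_1,n_2,k\ge2$ and let $T$ be the double broom $P(n_1-1,k,n_2-1)$, which has $n=n_1+n_2+k-2$ vertices. Then $$\operatorname{projdim} S/I(T^2)=\begin{cases} n-1, & k\in\{2,3\},\\ n-2, & 3<k\le 8,\\ n-2-\left\lceil\frac{k-8}5\right\rceil, & k>8,\end{cases}$$ where $S$ is the polynomial ring over a field $\Bbbk$ in one variable per vertex of $T$.
   Context: The double broom $P(n_1-1,k,n_2-1)$ is the tree obtained from a path $p_1,p_2,\dots,p_k$ on $k$ vertices by attaching $n_1-1$ new vertices of degree 1 to $p_1$ and $n_2-1$ new vertices of degree 1 to $p_k$. $T^2$ is the graph on $V(T)$ with edges the pairs at distance 1 or 2 in $T$. $I(G)=\langle x_ux_v:\{u,v\}\in E(G)\rangle$. $\operatorname{projdim}$ is projective dimension. *)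

theory Defs
  imports Complex_Main "HOL-Library.Poly_Mapping"
begin

text \<open>The double broom P(n1-1,k,n2-1) on vertex set {0..<n1+n2+k-2}:
  path vertices p_1,...,p_k are 0,...,k-1; the n1-1 leaves attached to p_1 are
  k,...,k+n1-2; the n2-1 leaves attached to p_k are k+n1-1,...,k+n1+n2-3.\<close>

definition double_broom_vertices :: "nat \<Rightarrow> nat \<Rightarrow> nat \<Rightarrow> nat set" where
  "double_broom_vertices n1 k n2 = {0..<n1 + n2 + k - 2}"

definition double_broom_edges :: "nat \<Rightarrow> nat \<Rightarrow> nat \<Rightarrow> nat set set" where
  "double_broom_edges n1 k n2 =
     {{i, i + 1} | i. i + 1 < k}
   \<union> {{0, j} | j. k \<le> j \<and> j < k + n1 - 1}
   \<union> {{k - 1, j} | j. k + n1 - 1 \<le> j \<and> j < k + n1 + n2 - 2}"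

definition graph_square :: "'v set set \<Rightarrow> 'v set set" where
  "graph_square E = E \<union> {{u, w} | u v w. u \<noteq> w \<and> {u, v} \<in> E \<and> {v, w} \<in> E}"

type_synonym ('v, 'k) mpoly = "('v \<Rightarrow>\<^sub>0 nat) \<Rightarrow>\<^sub>0 'k"

definition polys :: "'v set \<Rightarrow> ('v, 'k::field) mpoly set" where
  "polys V = {p :: ('v, 'k) mpoly. \<forall>m \<in> Poly_Mapping.keys p. Poly_Mapping.keys m \<subseteq> V}"

definition Var :: "'v \<Rightarrow> ('v, 'k::field) mpoly" where
  "Var v = Poly_Mapping.single (Poly_Mapping.single v 1) 1"

definition ideal_gen :: "'v set \<Rightarrow> ('v, 'k::field) mpoly set \<Rightarrow> ('v, 'k) mpoly set" where
  "ideal_gen V G = {p. \<exists>F c. finite F \<and> F \<subseteq> G \<and> (\<forall>g\<in>F. c g \<in> polys V) \<and>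
                           p = (\<Sum>g\<in>F. c g * g)}"

definition edge_ideal :: "'v set \<Rightarrow> 'v set set \<Rightarrow> ('v, 'k::field) mpoly set" where
  "edge_ideal V E = ideal_gen V {Var u * Var v | u v. {u, v} \<in> E \<and> u \<noteq> v}"

definition fvec :: "'v set \<Rightarrow> nat \<Rightarrow> (nat \<Rightarrow> ('v, 'k::field) mpoly) set" where
  "fvec V r = {x. (\<forall>j<r. x j \<in> polys V) \<and> (\<forall>j\<ge>r. x j = 0)}"

definition matvec :: "nat \<Rightarrow> nat \<Rightarrow> (nat \<Rightarrow> nat \<Rightarrow> ('v, 'k::field) mpoly)
                       \<Rightarrow> (nat \<Rightarrow> ('v, 'k) mpoly) \<Rightarrow> (nat \<Rightarrow> ('v, 'k) mpoly)" where
  "matvec r' r A x = (\<lambda>i. if i < r' then (\<Sum>j<r. A i j * x j) else 0)"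

text \<open>There is a free resolution of length n of S/I by finitely generated free S-modules
  0 \<rightarrow> S^(r n) \<rightarrow> ... \<rightarrow> S^(r 1) \<rightarrow> S^(r 0) \<rightarrow> S/I \<rightarrow> 0,
  where d i : S^(r i) \<rightarrow> S^(r (i-1)) and the augmentation sends e_j to g j mod I.\<close>
definition has_free_resolution :: "'v set \<Rightarrow> ('v, 'k::field) mpoly set \<Rightarrow> nat \<Rightarrow> bool" where
  "has_free_resolution V I n \<longleftrightarrow>
    (\<exists>(r :: nat \<Rightarrow> nat) (g :: nat \<Rightarrow> ('v, 'k) mpoly) (d :: nat \<Rightarrow> nat \<Rightarrow> nat \<Rightarrow> ('v, 'k) mpoly).
       (\<forall>j<r 0. g j \<in> polys V)
     \<and> (\<forall>i. 1 \<le> i \<and> i \<le> n \<longrightarrow> (\<forall>a<r (i - 1). \<forall>b<r i. d i a b \<in> polys V))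
     \<and> (\<forall>p\<in>polys V. \<exists>x\<in>fvec V (r 0). p - (\<Sum>j<r 0. x j * g j) \<in> I)
     \<and> {x\<in>fvec V (r 0). (\<Sum>j<r 0. x j * g j) \<in> I}
         = (if n = 0 then {\<lambda>_. 0} else matvec (r 0) (r 1) (d 1) ` fvec V (r 1))
     \<and> (\<forall>i. 1 \<le> i \<and> i \<le> n \<longrightarrow>
          {x\<in>fvec V (r i). matvec (r (i - 1)) (r i) (d i) x = (\<lambda>_. 0)}
            = (if i = n then {\<lambda>_. 0} else matvec (r i) (r (i + 1)) (d (i + 1)) ` fvec V (r (i + 1)))))"

definition projdim_quot :: "'v set \<Rightarrow> ('v, 'k::field) mpoly set \<Rightarrow> nat" where
  "projdim_quot V I = (LEAST n. has_free_resolution V I n)"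

end

theory Submission
  imports Defs "HOL-Library.Function_Algebras"
begin

text \<open>The projective dimension equals the number of vertices minus the least size of a maximal
  independent set, because the square of a double broom is chordal. In fact it is a unit interval
  graph: if the path vertices get the positions 1 to \<^term>\<open>k\<close> and the leaves at the two ends the
  positions 0 and \<^term>\<open>k + 1\<close>, adjacency means that the positions differ by at most 2. Every
  vertex thus dominates at most 5 positions, and the least size is \<^term>\<open>(k + 6) div 5\<close>.

  Lower bound: the product of the variables in a maximal independent set is killed, modulo the edge
  ideal, by all other variables; dividing out these variables one at a time shifts this element along
  the resolution, which therefore has at least as many steps as there are variables.

  Upper bound: for a variable \<open>x\<close> the exact sequence
  \<open>0 \<rightarrow> S/(I : x) \<rightarrow> S/I \<rightarrow> S/(I, x) \<rightarrow> 0\<close> and the horseshoe lemma reduce the claim to two smaller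
  graphs, provided that \<open>x\<close> is adjacent to a vertex whose closed neighbourhood it dominates.\<close>

section \<open>Monomial ideals generated by squarefree monomials\<close>

abbreviation supp :: "('a \<Rightarrow>\<^sub>0 'b::zero) \<Rightarrow> 'a set" where
  "supp \<equiv> Poly_Mapping.keys"

lemma supp_add_nat: "supp (a + b) = supp a \<union> supp (b :: 'v \<Rightarrow>\<^sub>0 nat)"
  by (auto simp: in_keys_iff lookup_add)

text \<open>This is an ideal only when \<^term>\<open>Q\<close> is upward closed.\<close>

definition mono_ideal :: "'v set \<Rightarrow> ('v set \<Rightarrow> bool) \<Rightarrow> ('v, 'k::field) mpoly set" where
  "mono_ideal V Q = {p \<in> polys V. \<forall>m\<in>supp p. Q (supp m)}"

lemma mono_ideal_polys: "p \<in> mono_ideal V Q \<Longrightarrow> p \<in> polys V"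
  by (simp add: mono_ideal_def)

lemma polys_eq_mono_ideal: "polys V = mono_ideal V (\<lambda>_. True)"
  by (auto simp: mono_ideal_def)

lemma mono_ideal_zero [simp]: "0 \<in> mono_ideal V Q"
  by (simp add: mono_ideal_def polys_def)

lemma mono_ideal_add: "p \<in> mono_ideal V Q \<Longrightarrow> q \<in> mono_ideal V Q \<Longrightarrow> p + q \<in> mono_ideal V Q"
  using keys_add[of p q] by (force simp: mono_ideal_def polys_def)

lemma mono_ideal_uminus: "p \<in> mono_ideal V Q \<Longrightarrow> - p \<in> mono_ideal V Q"
proof -
  have "supp (- p) = supp p" by (auto simp: in_keys_iff)
  then show "p \<in> mono_ideal V Q \<Longrightarrow> - p \<in> mono_ideal V Q"
    by (simp add: mono_ideal_def polys_def)
qed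

lemma mono_ideal_diff: "p \<in> mono_ideal V Q \<Longrightarrow> q \<in> mono_ideal V Q \<Longrightarrow> p - q \<in> mono_ideal V Q"
  using mono_ideal_add[of p V Q "- q"] mono_ideal_uminus[of q V Q] by simp

lemma mono_ideal_sum: "(\<And>i. i \<in> I \<Longrightarrow> f i \<in> mono_ideal V Q) \<Longrightarrow> sum f I \<in> mono_ideal V Q"
  by (induction I rule: infinite_finite_induct) (auto intro: mono_ideal_add)

lemma mono_ideal_mult:
  assumes "mono Q" and p: "p \<in> polys V" and q: "q \<in> mono_ideal V Q"
  shows "p * q \<in> mono_ideal V Q"
proof -
  have "supp m \<subseteq> V \<and> Q (supp m)" if mem: "m \<in> supp (p * q)" for m
  proof -
    obtain a b where m: "m = a + b" "a \<in> supp p" "b \<in> supp q"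
      using mem keys_mult[of p q] by blast
    have "Q (supp b)" "supp b \<subseteq> V" "supp a \<subseteq> V"
      using m p q by (auto simp: mono_ideal_def polys_def)
    moreover have "Q (supp b) \<le> Q (supp m)"
      using m by (intro monoD[OF \<open>mono Q\<close>]) (simp add: supp_add_nat)
    ultimately show ?thesis using m by (auto simp: supp_add_nat)
  qed
  then show ?thesis by (auto simp: mono_ideal_def polys_def)
qed

lemma polys_zero [simp]: "0 \<in> polys V"
  and polys_one [simp]: "1 \<in> polys V"
  by (auto simp: polys_def)

lemma polys_add: "p \<in> polys V \<Longrightarrow> q \<in> polys V \<Longrightarrow> p + q \<in> polys V"
  and polys_uminus: "p \<in> polys V \<Longrightarrow> - p \<in> polys V"
  and polys_diff: "p \<in> polys V \<Longrightarrow> q \<in> polys V \<Longrightarrow> p - q \<in> polys V"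
  unfolding polys_eq_mono_ideal by (auto intro: mono_ideal_add mono_ideal_uminus mono_ideal_diff)

lemma polys_sum: "(\<And>i. i \<in> I \<Longrightarrow> f i \<in> polys V) \<Longrightarrow> sum f I \<in> polys V"
  unfolding polys_eq_mono_ideal by (rule mono_ideal_sum)

lemma polys_mult: "p \<in> polys V \<Longrightarrow> q \<in> polys V \<Longrightarrow> p * q \<in> polys V"
  using mono_ideal_mult[of "\<lambda>_. True" p V q] by (simp add: polys_eq_mono_ideal[symmetric] mono_def)

lemma Var_polys [simp]: "v \<in> V \<Longrightarrow> Var v \<in> polys V"
  by (simp add: polys_def Var_def)

lemmas polys_intros = polys_zero polys_one polys_add polys_uminus polys_diff polys_sum polys_mult

lemma lookup_Var_mult:
  "Poly_Mapping.lookup (Var v * p) (Poly_Mapping.single v 1 + m) = Poly_Mapping.lookup p m"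
proof -
  let ?t = "Poly_Mapping.single v (1::nat)"
  have "Poly_Mapping.lookup (Var v * p) (?t + m)
      = (\<Sum>l. (\<Sum>q. Poly_Mapping.lookup p q when ?t + m = l + q) when l = ?t)"
    by (simp add: lookup_mult Var_def lookup_single when_mult eq_commute[of ?t])
  also have "\<dots> = (\<Sum>q. Poly_Mapping.lookup p q when m = q)"
    by simp
  finally show ?thesis by simp
qed

text \<open>Multiplication by a variable shifts all exponents, hence no terms cancel and the general
  inclusion for products becomes an equality.\<close>

lemma keys_Var_mult: "supp (Var v * p) = (+) (Poly_Mapping.single v 1) ` supp p"
proof -
  have "supp (Var v * p) \<subseteq> (+) (Poly_Mapping.single v 1) ` supp p"
    using keys_mult[of "Var v" p] by (auto simp: Var_def)
  moreover have "(+) (Poly_Mapping.single v 1) ` supp p \<subseteq> supp (Var v * p)"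
    by (auto simp: in_keys_iff lookup_Var_mult simp del: One_nat_def)
  ultimately show ?thesis by blast
qed

text \<open>By the exponent shift every support just gains \<open>v\<close>. Taking the colon by a
  variable thus turns into a substitution in the predicate.\<close>

lemma Var_mult_mem_mono_ideal:
  assumes "v \<in> V"
  shows "Var v * p \<in> mono_ideal V Q \<longleftrightarrow> p \<in> mono_ideal V (\<lambda>S. Q (insert v S))"
  using assms by (auto simp: mono_ideal_def polys_def keys_Var_mult supp_add_nat)

lemma mpoly_sum_singles:
  fixes p :: "('v, 'k::field) mpoly"
  shows "p = (\<Sum>m\<in>supp p. Poly_Mapping.single m (Poly_Mapping.lookup p m))"
proof (rule poly_mapping_eqI)
  fix k
  show "Poly_Mapping.lookup p k
      = Poly_Mapping.lookup (\<Sum>m\<in>supp p. Poly_Mapping.single m (Poly_Mapping.lookup p m)) k"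
    by (cases "k \<in> supp p")
      (auto simp: lookup_sum lookup_single in_keys_iff when_def sum.delta' if_distrib)
qed

text \<open>Each term of a member has an admissible support, and a polynomial is the sum of its
  terms, so additive claims need only be checked on single terms.\<close>

lemma mono_ideal_induct [consumes 1, case_names zero add single]:
  assumes "p \<in> mono_ideal V Q"
    and "P 0" and add: "\<And>p q. P p \<Longrightarrow> P q \<Longrightarrow> P (p + q)"
    and single: "\<And>m c. supp m \<subseteq> V \<Longrightarrow> Q (supp m) \<Longrightarrow> P (Poly_Mapping.single m c)"
  shows "P p"
proof -
  have *: "P (Poly_Mapping.single m (Poly_Mapping.lookup p m))" if "m \<in> supp p" for m
    using that assms(1) by (intro single) (auto simp: mono_ideal_def polys_def)
  have "P (\<Sum>m\<in>M. Poly_Mapping.single m (Poly_Mapping.lookup p m))" if "finite M" "M \<subseteq> supp p" for M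
    using that by (induction M rule: finite_induct) (auto intro: assms *)
  from this[of "supp p"] show ?thesis using mpoly_sum_singles[of p] by simp
qed

lemma single_eq_Var_mult:
  assumes "v \<in> supp (m :: 'v \<Rightarrow>\<^sub>0 nat)"
  obtains m' where "Poly_Mapping.single m c = Var v * Poly_Mapping.single m' (c::'k::field)"
    and "m = Poly_Mapping.single v 1 + m'"
proof
  have "m = Poly_Mapping.single v 1 + (m - Poly_Mapping.single v 1)"
    using assms
    by (intro poly_mapping_eqI) (auto simp: lookup_add lookup_minus lookup_single when_def in_keys_iff)
  then show "m = Poly_Mapping.single v 1 + (m - Poly_Mapping.single v 1)"
    "Poly_Mapping.single m c = Var v * Poly_Mapping.single (m - Poly_Mapping.single v 1) c"
    by (auto simp: Var_def mult_single)
qed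

text \<open>A term whose support contains \<open>v\<close> is divisible by \<open>Var v\<close>; any
  other term already satisfies \<open>Q\<close>. The congruence on the right is the form of J + (v)
  to which boundary maps can be applied.\<close>

lemma mono_ideal_add_Var:
  assumes "v \<in> V"
  shows "p \<in> mono_ideal V (\<lambda>S. Q S \<or> v \<in> S) \<longleftrightarrow>
    (\<exists>q\<in>polys V. p - Var v * q \<in> mono_ideal V Q)"
proof
  assume "p \<in> mono_ideal V (\<lambda>S. Q S \<or> v \<in> S)"
  then show "\<exists>q\<in>polys V. p - Var v * q \<in> mono_ideal V Q"
  proof (induction rule: mono_ideal_induct)
    case zero
    then show ?case by (intro bexI[of _ 0]) auto
  next
    case (add p q)
    then obtain a b where ab: "a \<in> polys V" "b \<in> polys V"
      "p - Var v * a \<in> mono_ideal V Q" "q - Var v * b \<in> mono_ideal V Q" by blast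
    then show ?case
      using mono_ideal_add[OF ab(3,4)] by (intro bexI[of _ "a + b"]) (auto intro: polys_add simp: algebra_simps)
  next
    case (single m c)
    show ?case
    proof (cases "Q (supp m)")
      case True
      then show ?thesis using single by (intro bexI[of _ 0]) (auto simp: mono_ideal_def polys_def)
    next
      case False
      with single obtain m' where m': "Poly_Mapping.single m c = Var v * Poly_Mapping.single m' c"
        "m = Poly_Mapping.single v 1 + m'" using single_eq_Var_mult by metis
      then show ?thesis using single
        by (intro bexI[of _ "Poly_Mapping.single m' c"]) (auto simp: polys_def supp_add_nat)
    qed
  qed
next
  assume "\<exists>q\<in>polys V. p - Var v * q \<in> mono_ideal V Q"
  then obtain q where q: "q \<in> polys V" "p - Var v * q \<in> mono_ideal V Q" by blast
  have "Var v * q \<in> mono_ideal V (\<lambda>S. Q S \<or> v \<in> S)"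
    using q assms by (subst Var_mult_mem_mono_ideal) (auto simp: mono_ideal_def)
  moreover have "p - Var v * q \<in> mono_ideal V (\<lambda>S. Q S \<or> v \<in> S)"
    using q by (auto simp: mono_ideal_def)
  ultimately show "p \<in> mono_ideal V (\<lambda>S. Q S \<or> v \<in> S)"
    using mono_ideal_add by fastforce
qed

section \<open>Edge ideals as monomial ideals\<close>

lemma ideal_gen_add:
  fixes G :: "('v, 'k::field) mpoly set"
  assumes "p \<in> ideal_gen V G" "q \<in> ideal_gen V G"
  shows "p + q \<in> ideal_gen V G"
proof -
  obtain F c where F: "finite F" "F \<subseteq> G" "\<forall>g\<in>F. c g \<in> polys V" "p = (\<Sum>g\<in>F. c g * g)"
    using assms(1) by (auto simp: ideal_gen_def)
  obtain H d where H: "finite H" "H \<subseteq> G" "\<forall>g\<in>H. d g \<in> polys V" "q = (\<Sum>g\<in>H. d g * g)"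
    using assms(2) by (auto simp: ideal_gen_def)
  \<comment> \<open>The two representations may use different generators; both coefficient functions
    are extended by zero to \<open>F \<union> H\<close>.\<close>
  define e where "e g = (if g \<in> F then c g else 0) + (if g \<in> H then d g else 0)" for g
  have "p = (\<Sum>g\<in>F \<union> H. (if g \<in> F then c g else 0) * g)"
    unfolding F(4) using F(1) H(1) by (intro sum.mono_neutral_cong_left) auto
  moreover have "q = (\<Sum>g\<in>F \<union> H. (if g \<in> H then d g else 0) * g)"
    unfolding H(4) using F(1) H(1) by (intro sum.mono_neutral_cong_left) auto
  ultimately have "p + q = (\<Sum>g\<in>F \<union> H. e g * g)"
    by (simp add: e_def distrib_right sum.distrib)
  moreover have "\<forall>g\<in>F \<union> H. e g \<in> polys V"
    using F H by (auto simp: e_def intro!: polys_add)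
  ultimately show ?thesis
    using F H unfolding ideal_gen_def by (intro CollectI exI[of _ "F \<union> H"] exI[of _ e]) simp
qed

text \<open>A term whose support contains both ends of an edge is a multiple of that generator, so
  membership in the edge ideal can be read off the supports, term by term.\<close>

lemma edge_ideal_eq_mono_ideal:
  assumes E: "\<And>u v. {u, v} \<in> E \<Longrightarrow> u \<noteq> v \<Longrightarrow> u \<in> V \<and> v \<in> V"
  shows "(edge_ideal V E :: ('v, 'k::field) mpoly set)
    = mono_ideal V (\<lambda>S. \<exists>u v. u \<noteq> v \<and> {u, v} \<in> E \<and> u \<in> S \<and> v \<in> S)" (is "_ = mono_ideal V ?Q")
proof (intro equalityI subsetI)
  have mono: "mono ?Q" by (auto simp: mono_def)
  fix p :: "('v, 'k) mpoly"
  assume "p \<in> edge_ideal V E"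
  then obtain F c where F: "finite F" "F \<subseteq> {Var u * Var v | u v. {u, v} \<in> E \<and> u \<noteq> v}"
    "\<forall>g\<in>F. c g \<in> polys V" "p = (\<Sum>g\<in>F. c g * g)"
    unfolding edge_ideal_def ideal_gen_def by blast
  show "p \<in> mono_ideal V ?Q"
    unfolding F(4)
  proof (intro mono_ideal_sum mono_ideal_mult[OF mono])
    fix g assume "g \<in> F"
    then obtain u v where uv: "g = Var u * Var v" "{u, v} \<in> E" "u \<noteq> v" using F by blast
    then have "u \<in> V" "v \<in> V" using E by auto
    then show "g \<in> mono_ideal V ?Q"
      using uv by (auto simp: mono_ideal_def polys_def keys_Var_mult supp_add_nat) (auto simp: Var_def)
  qed (use F in auto)
next
  fix p :: "('v, 'k) mpoly"
  assume "p \<in> mono_ideal V ?Q"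
  then show "p \<in> edge_ideal V E"
  proof (induction rule: mono_ideal_induct)
    case zero
    then show ?case by (auto simp: edge_ideal_def ideal_gen_def intro: exI[of _ "{}"])
  next
    case (add p q)
    then show ?case by (simp add: edge_ideal_def ideal_gen_add)
  next
    case (single m c)
    then obtain u v where uv: "u \<noteq> v" "{u, v} \<in> E" "u \<in> supp m" "v \<in> supp m" by blast
    obtain a where a: "Poly_Mapping.single m c = Var u * Poly_Mapping.single a c"
      "m = Poly_Mapping.single u 1 + a"
      using single_eq_Var_mult[OF uv(3)] by metis
    then have "v \<in> supp a" using uv by (auto simp: supp_add_nat)
    then obtain b where b: "Poly_Mapping.single a c = Var v * Poly_Mapping.single b c"
      "a = Poly_Mapping.single v 1 + b"
      using single_eq_Var_mult by metis
    have "Poly_Mapping.single b c \<in> polys V"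
      using a b single by (auto simp: polys_def supp_add_nat)
    moreover have "Poly_Mapping.single m c = Poly_Mapping.single b c * (Var u * Var v)"
      unfolding a(1) b(1) by (simp only: mult_ac)
    ultimately show ?case
      unfolding edge_ideal_def ideal_gen_def using uv(1,2)
      by (intro CollectI exI[of _ "{Var u * Var v}"] exI[of _ "\<lambda>_. Poly_Mapping.single b c"])
        (simp, blast)
  qed
qed

section \<open>Vectors and matrices over the polynomial ring\<close>

text \<open>The scalar becomes a constant function, so that pointwise multiplication and the ring
  laws for functions apply to vectors.\<close>

abbreviation smul :: "'a \<Rightarrow> (nat \<Rightarrow> 'a::times) \<Rightarrow> nat \<Rightarrow> 'a" (infixr "*v" 70) where
  "c *v x \<equiv> (\<lambda>_. c) * x"

lemma fvec_zero [simp]: "0 \<in> fvec V r"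
  and fvec_add: "x \<in> fvec V r \<Longrightarrow> y \<in> fvec V r \<Longrightarrow> x + y \<in> fvec V r"
  and fvec_diff: "x \<in> fvec V r \<Longrightarrow> y \<in> fvec V r \<Longrightarrow> x - y \<in> fvec V r"
  and fvec_smul: "c \<in> polys V \<Longrightarrow> x \<in> fvec V r \<Longrightarrow> c *v x \<in> fvec V r"
  by (auto simp: fvec_def intro: polys_intros)

lemma fvec_no_components [simp]: "fvec V 0 = {0}"
  by (auto simp: fvec_def fun_eq_iff)

lemma matvec_add: "matvec r' r A (x + y) = matvec r' r A x + matvec r' r A y"
  by (auto simp: matvec_def fun_eq_iff algebra_simps sum.distrib)

lemma matvec_diff: "matvec r' r A (x - y) = matvec r' r A x - matvec r' r A y"
  by (auto simp: matvec_def fun_eq_iff algebra_simps sum_subtractf)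

lemma matvec_smul: "matvec r' r A (c *v x) = c *v matvec r' r A x"
  by (auto simp: matvec_def fun_eq_iff sum_distrib_left intro!: sum.cong)

lemma matvec_zero [simp]: "matvec r' r A 0 = 0"
  by (auto simp: matvec_def fun_eq_iff)

lemma matvec_fvec:
  assumes "\<And>a b. a < r' \<Longrightarrow> b < r \<Longrightarrow> A a b \<in> polys V" "x \<in> fvec V r"
  shows "matvec r' r A x \<in> fvec V r'"
  using assms by (auto simp: matvec_def fvec_def intro!: polys_sum polys_mult)

text \<open>For upward closed \<open>Q\<close> this is J F, with F the free module of rank
  \<open>r\<close> and J the monomial ideal. Membership of a difference expresses congruence modulo
  J without forming quotients.\<close>

definition mono_vec :: "'v set \<Rightarrow> ('v set \<Rightarrow> bool) \<Rightarrow> nat \<Rightarrow> (nat \<Rightarrow> ('v, 'k::field) mpoly) set" where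
  "mono_vec V Q r = {x. (\<forall>j<r. x j \<in> mono_ideal V Q) \<and> (\<forall>j\<ge>r. x j = 0)}"

lemma mono_vec_zero [simp]: "0 \<in> mono_vec V Q r"
  and mono_vec_add: "x \<in> mono_vec V Q r \<Longrightarrow> y \<in> mono_vec V Q r \<Longrightarrow> x + y \<in> mono_vec V Q r"
  and mono_vec_diff: "x \<in> mono_vec V Q r \<Longrightarrow> y \<in> mono_vec V Q r \<Longrightarrow> x - y \<in> mono_vec V Q r"
  by (auto simp: mono_vec_def intro: mono_ideal_add mono_ideal_diff)

lemma mono_vec_smul:
  "mono Q \<Longrightarrow> c \<in> polys V \<Longrightarrow> x \<in> mono_vec V Q r \<Longrightarrow> c *v x \<in> mono_vec V Q r"
  by (auto simp: mono_vec_def intro: mono_ideal_mult)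

lemma matvec_mono_vec:
  assumes "mono Q" "\<And>a b. a < r' \<Longrightarrow> b < r \<Longrightarrow> A a b \<in> polys V" "x \<in> mono_vec V Q r"
  shows "matvec r' r A x \<in> mono_vec V Q r'"
  using assms by (auto simp: matvec_def mono_vec_def intro!: mono_ideal_sum mono_ideal_mult)

lemma mono_vec_add_Var:
  assumes "v \<in> V"
  shows "x \<in> mono_vec V (\<lambda>S. Q S \<or> v \<in> S) r \<longleftrightarrow> (\<exists>y\<in>fvec V r. x - Var v *v y \<in> mono_vec V Q r)"
proof
  assume x: "x \<in> mono_vec V (\<lambda>S. Q S \<or> v \<in> S) r"
  then have "\<forall>j. \<exists>q. j < r \<longrightarrow> q \<in> polys V \<and> x j - Var v * q \<in> mono_ideal V Q"
    using mono_ideal_add_Var[OF assms] by (fastforce simp: mono_vec_def)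
  then obtain y where "\<forall>j. j < r \<longrightarrow> y j \<in> polys V \<and> x j - Var v * y j \<in> mono_ideal V Q"
    by metis
  then show "\<exists>y\<in>fvec V r. x - Var v *v y \<in> mono_vec V Q r"
    using x by (intro bexI[of _ "\<lambda>j. if j < r then y j else 0"]) (auto simp: mono_vec_def fvec_def)
next
  assume "\<exists>y\<in>fvec V r. x - Var v *v y \<in> mono_vec V Q r"
  then obtain y where "y \<in> fvec V r" "x - Var v *v y \<in> mono_vec V Q r" by blast
  then show "x \<in> mono_vec V (\<lambda>S. Q S \<or> v \<in> S) r"
    using mono_ideal_add_Var[OF assms, where Q = Q] by (fastforce simp: mono_vec_def fvec_def)
qed

text \<open>Since \<open>Q\<close> ignores \<open>v\<close>, the variable is a non-zero-divisor
  modulo the ideal.\<close>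

lemma mono_vec_cancel_Var:
  assumes "v \<in> V" "\<And>S. Q (insert v S) = Q S" "x \<in> fvec V r" "Var v *v x \<in> mono_vec V Q r"
  shows "x \<in> mono_vec V Q r"
  using assms by (auto simp: mono_vec_def fvec_def Var_mult_mem_mono_ideal)

text \<open>The predicate is written as the instance \<open>D = {}\<close> of the family
  \<open>\<lambda>S. D \<inter> S \<noteq> {}\<close> used below: congruence modulo no variables is
  equality.\<close>

lemma mono_vec_False: "mono_vec V (\<lambda>S. {} \<inter> S \<noteq> {}) s = {0}"
  by (auto simp: mono_vec_def mono_ideal_def fun_eq_iff polys_def) (metis linorder_not_le)

lemma mono_meets: "mono (\<lambda>S. D \<inter> S \<noteq> {})"
  by (auto simp: mono_def)

section \<open>A lower bound for the length of a resolution\<close>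

text \<open>Here \<^term>\<open>d i\<close> is the map from the free module of rank \<^term>\<open>r (Suc i)\<close> to the one of
  rank \<^term>\<open>r i\<close>.\<close>

locale exact_complex =
  fixes V :: "'v set" and r :: "nat \<Rightarrow> nat" and d :: "nat \<Rightarrow> nat \<Rightarrow> nat \<Rightarrow> ('v, 'k::field) mpoly"
  assumes entries: "a < r i \<Longrightarrow> b < r (Suc i) \<Longrightarrow> d i a b \<in> polys V"
    and exact: "{y \<in> fvec V (r (Suc i)). matvec (r i) (r (Suc i)) (d i) y = 0}
      = matvec (r (Suc i)) (r (Suc (Suc i))) (d (Suc i)) ` fvec V (r (Suc (Suc i)))"
begin

abbreviation bd :: "nat \<Rightarrow> (nat \<Rightarrow> ('v, 'k) mpoly) \<Rightarrow> nat \<Rightarrow> ('v, 'k) mpoly" where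
  "bd i \<equiv> matvec (r i) (r (Suc i)) (d i)"

lemma bd_fvec: "y \<in> fvec V (r (Suc i)) \<Longrightarrow> bd i y \<in> fvec V (r i)"
  by (intro matvec_fvec entries)

lemma bd_bd: "y \<in> fvec V (r (Suc (Suc i))) \<Longrightarrow> bd i (bd (Suc i) y) = 0"
  using exact[of i] by blast

lemma bd_mono_vec: "mono Q \<Longrightarrow> y \<in> mono_vec V Q (r (Suc i)) \<Longrightarrow> bd i y \<in> mono_vec V Q (r i)"
  by (intro matvec_mono_vec entries)

text \<open>Exactness, at the module of rank \<open>r (Suc i)\<close>, of the complex reduced modulo
  the variables in \<open>D\<close>.\<close>

definition exact_mod :: "'v set \<Rightarrow> nat \<Rightarrow> bool" where
  "exact_mod D i \<longleftrightarrow> (\<forall>y\<in>fvec V (r (Suc i)). bd i y \<in> mono_vec V (\<lambda>S. D \<inter> S \<noteq> {}) (r i) \<longrightarrow>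
     (\<exists>w\<in>fvec V (r (Suc (Suc i))). y - bd (Suc i) w \<in> mono_vec V (\<lambda>S. D \<inter> S \<noteq> {}) (r (Suc i))))"

lemma exact_mod_empty: "exact_mod {} i"
  using exact[of i] unfolding exact_mod_def mono_vec_False by (auto simp del: fvec_no_components)

text \<open>A cycle \<open>y\<close> modulo \<open>D\<close> and \<open>c\<close> has boundary
  \<open>c z\<close> modulo \<open>D\<close>. As \<open>c\<close> is regular modulo
  \<open>D\<close>, \<open>z\<close> is a cycle modulo \<open>D\<close>, hence a boundary of some
  \<open>w\<close>, and \<open>y - c w\<close> is a cycle modulo \<open>D\<close>. Two consecutive
  positions are used, so each new variable costs the lowest position of exactness.\<close>

lemma exact_mod_insert:
  assumes D: "exact_mod D i" "exact_mod D (Suc i)" and c: "c \<in> V" "c \<notin> D"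
  shows "exact_mod (insert c D) (Suc i)"
  unfolding exact_mod_def
proof (intro ballI impI)
  let ?Q = "\<lambda>S. D \<inter> S \<noteq> {}"
  have ins: "(\<lambda>S. insert c D \<inter> S \<noteq> {}) = (\<lambda>S. ?Q S \<or> c \<in> S)" by auto
  fix y assume y: "y \<in> fvec V (r (Suc (Suc i)))"
    "bd (Suc i) y \<in> mono_vec V (\<lambda>S. insert c D \<inter> S \<noteq> {}) (r (Suc i))"
  obtain z where z: "z \<in> fvec V (r (Suc i))" "bd (Suc i) y - Var c *v z \<in> mono_vec V ?Q (r (Suc i))"
    using y(2)[unfolded ins mono_vec_add_Var[OF c(1)]] by (elim bexE)
  have "bd i (bd (Suc i) y - Var c *v z) \<in> mono_vec V ?Q (r i)"
    by (rule bd_mono_vec[OF mono_meets z(2)])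
  then have "0 - Var c *v bd i z \<in> mono_vec V ?Q (r i)"
    using bd_bd[OF y(1)] by (simp add: matvec_diff matvec_smul)
  from mono_vec_diff[OF mono_vec_zero this] have "Var c *v bd i z \<in> mono_vec V ?Q (r i)"
    by simp
  then have "bd i z \<in> mono_vec V ?Q (r i)"
    by (rule mono_vec_cancel_Var[OF c(1) _ bd_fvec[OF z(1)], rotated]) (use c in auto)
  then obtain w where w: "w \<in> fvec V (r (Suc (Suc i)))" "z - bd (Suc i) w \<in> mono_vec V ?Q (r (Suc i))"
    using D(1) z(1) unfolding exact_mod_def by blast
  have "(bd (Suc i) y - Var c *v z) + Var c *v (z - bd (Suc i) w) \<in> mono_vec V ?Q (r (Suc i))"
    by (intro mono_vec_add z(2) mono_vec_smul w(2) mono_meets Var_polys c)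
  moreover have "(bd (Suc i) y - Var c *v z) + Var c *v (z - bd (Suc i) w) = bd (Suc i) (y - Var c *v w)"
    by (simp add: matvec_diff matvec_smul right_diff_distrib)
  ultimately have "bd (Suc i) (y - Var c *v w) \<in> mono_vec V ?Q (r (Suc i))" by simp
  moreover have "y - Var c *v w \<in> fvec V (r (Suc (Suc i)))"
    by (intro fvec_diff y fvec_smul w Var_polys c)
  ultimately obtain v where v: "v \<in> fvec V (r (Suc (Suc (Suc i))))"
    "y - Var c *v w - bd (Suc (Suc i)) v \<in> mono_vec V ?Q (r (Suc (Suc i)))"
    using D(2) unfolding exact_mod_def by blast
  have "y - bd (Suc (Suc i)) v - Var c *v w \<in> mono_vec V ?Q (r (Suc (Suc i)))"
    using v(2) by (simp add: algebra_simps)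
  then show "\<exists>w\<in>fvec V (r (Suc (Suc (Suc i)))).
      y - bd (Suc (Suc i)) w \<in> mono_vec V (\<lambda>S. insert c D \<inter> S \<noteq> {}) (r (Suc (Suc i)))"
    unfolding ins mono_vec_add_Var[OF c(1)] using v(1) w(1) by blast
qed

text \<open>An element of the cokernel of \<^term>\<open>bd i\<close> modulo the variables in \<^term>\<open>D\<close> that is killed
  by the variable \<^term>\<open>c\<close> and by the rest of \<^term>\<open>C\<close> yields, by dividing its \<^term>\<open>c\<close>-multiple
  by the boundary map, an element one step further to the left that survives modulo
  \<^term>\<open>insert c D\<close>.\<close>

lemma socle_shift:
  assumes "finite C" "C \<subseteq> V" "D \<subseteq> C" "\<And>j. i \<le> j \<Longrightarrow> exact_mod D j"
    and "f \<in> fvec V (r i)"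
    and "\<And>w. w \<in> fvec V (r (Suc i)) \<Longrightarrow> f - bd i w \<notin> mono_vec V (\<lambda>S. D \<inter> S \<noteq> {}) (r i)"
    and "\<And>c. c \<in> C - D \<Longrightarrow>
      \<exists>w\<in>fvec V (r (Suc i)). Var c *v f - bd i w \<in> mono_vec V (\<lambda>S. D \<inter> S \<noteq> {}) (r i)"
  shows "r (i + card (C - D)) \<noteq> 0"
  using assms
proof (induction "card (C - D)" arbitrary: D i f)
  case 0
  have "r i \<noteq> 0"
  proof
    assume "r i = 0"
    then have "f - bd i 0 = 0" using 0 by simp
    then show False using "0.prems"(6)[OF fvec_zero] mono_vec_zero by metis
  qed
  then show ?case using 0 by simp
next
  case (Suc n)
  let ?Q = "\<lambda>S. D \<inter> S \<noteq> {}"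
  have "C - D \<noteq> {}" using Suc.hyps(2) by (metis card.empty nat.distinct(1))
  then obtain c where c: "c \<in> C - D" by blast
  then have cV: "c \<in> V" using Suc.prems by blast
  have ins: "(\<lambda>S. insert c D \<inter> S \<noteq> {}) = (\<lambda>S. ?Q S \<or> c \<in> S)" by auto
  obtain g where g: "g \<in> fvec V (r (Suc i))" "Var c *v f - bd i g \<in> mono_vec V ?Q (r i)"
    using Suc.prems(7) c by blast
  have card: "n = card (C - insert c D)"
    using Suc.hyps(2) c Suc.prems(1) Diff_insert[of C c D] card_Diff_singleton[of c "C - D"] by simp
  have "r (Suc i + card (C - insert c D)) \<noteq> 0"
  proof (rule Suc.hyps(1)[OF card Suc.prems(1,2) _ _ g(1)])
    show "insert c D \<subseteq> C" using c Suc.prems by blast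
    show "exact_mod (insert c D) j" if ij: "Suc i \<le> j" for j
    proof -
      obtain l where "j = Suc l" "i \<le> l" using ij by (cases j) auto
      then show ?thesis using exact_mod_insert[OF _ _ cV] Suc.prems(4) c by simp
    qed
  next
    fix w :: "nat \<Rightarrow> ('v, 'k) mpoly"
    assume w: "w \<in> fvec V (r (Suc (Suc i)))"
    show "g - bd (Suc i) w \<notin> mono_vec V (\<lambda>S. insert c D \<inter> S \<noteq> {}) (r (Suc i))"
    proof
      assume "g - bd (Suc i) w \<in> mono_vec V (\<lambda>S. insert c D \<inter> S \<noteq> {}) (r (Suc i))"
      then obtain v where v: "v \<in> fvec V (r (Suc i))"
        "g - bd (Suc i) w - Var c *v v \<in> mono_vec V ?Q (r (Suc i))"
        unfolding ins mono_vec_add_Var[OF cV] by blast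
      \<comment> \<open>Applying \<open>bd i\<close> gives \<open>c f = bd i g = c (bd i v)\<close>
        modulo \<open>D\<close>; cancelling the regular \<open>c\<close> would make \<open>f\<close>
        a boundary.\<close>
      have "bd i (g - bd (Suc i) w - Var c *v v) \<in> mono_vec V ?Q (r i)"
        by (rule bd_mono_vec[OF mono_meets v(2)])
      then have "bd i g - Var c *v bd i v \<in> mono_vec V ?Q (r i)"
        using bd_bd[OF w] by (simp add: matvec_diff matvec_smul)
      from mono_vec_add[OF g(2) this] have "Var c *v (f - bd i v) \<in> mono_vec V ?Q (r i)"
        by (simp add: algebra_simps)
      then have "f - bd i v \<in> mono_vec V ?Q (r i)"
        by (rule mono_vec_cancel_Var[OF cV _ fvec_diff[OF Suc.prems(5) bd_fvec[OF v(1)]], rotated])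
          (use c in auto)
      then show False using Suc.prems(6) v(1) by blast
    qed
  next
    fix x assume x: "x \<in> C - insert c D"
    then have xV: "x \<in> V" using Suc.prems by blast
    obtain h where h: "h \<in> fvec V (r (Suc i))" "Var x *v f - bd i h \<in> mono_vec V ?Q (r i)"
      using Suc.prems(7)[of x] x by blast
    \<comment> \<open>The two ways of forming \<open>c x f\<close> agree, so
      \<open>x g - c h\<close> is a cycle modulo \<open>D\<close> and therefore a boundary; modulo
      \<open>c\<close> this shows that \<open>x\<close> kills the class of \<open>g\<close>.\<close>
    have "Var c *v (Var x *v f - bd i h) - Var x *v (Var c *v f - bd i g) \<in> mono_vec V ?Q (r i)"
      by (intro mono_vec_diff mono_vec_smul mono_meets g(2) h(2) Var_polys cV xV)
    moreover have "Var c *v (Var x *v f - bd i h) - Var x *v (Var c *v f - bd i g)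
        = bd i (Var x *v g - Var c *v h)"
      unfolding matvec_diff matvec_smul by (simp only: algebra_simps)
    ultimately have "bd i (Var x *v g - Var c *v h) \<in> mono_vec V ?Q (r i)" by simp
    moreover have "Var x *v g - Var c *v h \<in> fvec V (r (Suc i))"
      by (intro fvec_diff fvec_smul g(1) h(1) Var_polys cV xV)
    ultimately obtain w where w: "w \<in> fvec V (r (Suc (Suc i)))"
      "Var x *v g - Var c *v h - bd (Suc i) w \<in> mono_vec V ?Q (r (Suc i))"
      using Suc.prems(4)[of i] unfolding exact_mod_def by blast
    have "Var x *v g - bd (Suc i) w - Var c *v h \<in> mono_vec V ?Q (r (Suc i))"
      using w(2) by (simp add: algebra_simps)
    then show "\<exists>w\<in>fvec V (r (Suc (Suc i))).
        Var x *v g - bd (Suc i) w \<in> mono_vec V (\<lambda>S. insert c D \<inter> S \<noteq> {}) (r (Suc i))"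
      unfolding ins mono_vec_add_Var[OF cV] using w(1) h(1) by blast
  qed
  then show ?case unfolding card[symmetric] Suc.hyps(2)[symmetric] by simp
qed

end

section \<open>Ideals, augmentations and the length of a resolution\<close>

definition is_ideal :: "'v set \<Rightarrow> ('v, 'k::field) mpoly set \<Rightarrow> bool" where
  "is_ideal V J \<longleftrightarrow> J \<subseteq> polys V \<and> 0 \<in> J \<and> (\<forall>p\<in>J. \<forall>q\<in>J. p + q \<in> J) \<and>
     (\<forall>c\<in>polys V. \<forall>p\<in>J. c * p \<in> J)"

lemma is_idealD:
  assumes "is_ideal V J"
  shows ideal_polys: "p \<in> J \<Longrightarrow> p \<in> polys V"
    and ideal_zero: "0 \<in> J"
    and ideal_add: "p \<in> J \<Longrightarrow> q \<in> J \<Longrightarrow> p + q \<in> J"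
    and ideal_mult: "c \<in> polys V \<Longrightarrow> p \<in> J \<Longrightarrow> c * p \<in> J"
  using assms by (auto simp: is_ideal_def)

lemma ideal_diff:
  assumes "is_ideal V J" "p \<in> J" "q \<in> J"
  shows "p - q \<in> J"
proof -
  have "- 1 * q \<in> J" by (intro ideal_mult[OF assms(1)] polys_uminus polys_one assms(3))
  from ideal_add[OF assms(1,2) this] show ?thesis by simp
qed

lemma is_ideal_mono_ideal: "mono Q \<Longrightarrow> is_ideal V (mono_ideal V Q)"
  by (auto simp: is_ideal_def mono_ideal_polys mono_ideal_add mono_ideal_mult)

definition dot :: "nat \<Rightarrow> (nat \<Rightarrow> 'a::comm_ring_1) \<Rightarrow> (nat \<Rightarrow> 'a) \<Rightarrow> 'a" where
  "dot r x g = (\<Sum>j<r. x j * g j)"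

lemma dot_add: "dot r (x + y) g = dot r x g + dot r y g"
  and dot_diff: "dot r (x - y) g = dot r x g - dot r y g"
  and dot_smul: "dot r (c *v x) g = c * dot r x g"
  and dot_smul_right: "dot r x (c *v g) = c * dot r x g"
  and dot_zero [simp]: "dot r 0 g = 0"
  by (simp_all add: dot_def algebra_simps sum.distrib sum_subtractf sum_distrib_left)

lemma dot_polys: "x \<in> fvec V r \<Longrightarrow> \<forall>j<r. g j \<in> polys V \<Longrightarrow> dot r x g \<in> polys V"
  by (auto simp: dot_def fvec_def intro!: polys_sum polys_mult)

text \<open>The finite resolution is padded with zero modules and the maps are reindexed by one, so
  that exactness holds at every position without a special case at the left end.\<close>

lemma has_free_resolution_exact_complex:
  fixes I :: "('v, 'k::field) mpoly set"
  assumes "has_free_resolution V I n"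
  obtains r g d where "exact_complex V r d" "\<And>i. n < i \<Longrightarrow> r i = 0"
    "\<forall>j<r 0. g j \<in> polys V" "\<And>p. p \<in> polys V \<Longrightarrow> \<exists>x\<in>fvec V (r 0). p - dot (r 0) x g \<in> I"
    "{x \<in> fvec V (r 0). dot (r 0) x g \<in> I} = matvec (r 0) (r (Suc 0)) (d 0) ` fvec V (r (Suc 0))"
proof -
  obtain r and g :: "nat \<Rightarrow> ('v, 'k) mpoly" and d where
    g: "\<forall>j<r 0. g j \<in> polys V" "\<forall>p\<in>polys V. \<exists>x\<in>fvec V (r 0). p - dot (r 0) x g \<in> I"
    and d: "\<forall>i. 1 \<le> i \<and> i \<le> n \<longrightarrow> (\<forall>a<r (i - 1). \<forall>b<r i. d i a b \<in> polys V)"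
    and ex0: "{x \<in> fvec V (r 0). dot (r 0) x g \<in> I}
      = (if n = 0 then {0} else matvec (r 0) (r 1) (d 1) ` fvec V (r 1))"
    and ex: "\<forall>i. 1 \<le> i \<and> i \<le> n \<longrightarrow> {x \<in> fvec V (r i). matvec (r (i - 1)) (r i) (d i) x = 0}
      = (if i = n then {0} else matvec (r i) (r (i + 1)) (d (i + 1)) ` fvec V (r (i + 1)))"
    using assms unfolding has_free_resolution_def dot_def[symmetric] zero_fun_def[symmetric] by blast
  define r' where "r' i = (if i \<le> n then r i else 0)" for i
  define d' where "d' i = d (Suc i)" for i
  show thesis
  proof
    show "exact_complex V r' d'"
    proof
      show "d' i a b \<in> polys V" if "a < r' i" "b < r' (Suc i)" for i a b
        using that d[rule_format, of "Suc i" a b] by (auto simp: r'_def d'_def split: if_splits)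
      show "{y \<in> fvec V (r' (Suc i)). matvec (r' i) (r' (Suc i)) (d' i) y = 0}
        = matvec (r' (Suc i)) (r' (Suc (Suc i))) (d' (Suc i)) ` fvec V (r' (Suc (Suc i)))" for i
      proof (cases "i < n")
        case True
        then show ?thesis
          using ex[rule_format, of "Suc i"] by (cases "n = Suc i") (simp_all add: r'_def d'_def)
      next
        case False
        then have "r' (Suc i) = 0" "r' (Suc (Suc i)) = 0" by (simp_all add: r'_def)
        then show ?thesis by auto
      qed
    qed
    show "{x \<in> fvec V (r' 0). dot (r' 0) x g \<in> I}
      = matvec (r' 0) (r' (Suc 0)) (d' 0) ` fvec V (r' (Suc 0))"
      using ex0 by (cases "n = 0") (simp_all add: r'_def d'_def)
    show "\<forall>j<r' 0. g j \<in> polys V" using g(1) by (simp add: r'_def)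
    show "\<exists>x\<in>fvec V (r' 0). p - dot (r' 0) x g \<in> I" if "p \<in> polys V" for p
      using g(2) that by (simp add: r'_def)
  qed (simp add: r'_def)
qed

text \<open>Lifting \<open>u\<close> to the first free module gives a vector that is not a boundary,
  while each of its multiples by a variable in \<open>C\<close> is one. \<open>socle_shift\<close>,
  started with no variables at position 0, then forces the module at position \<open>card C\<close>
  to be nonzero.\<close>

lemma card_le_resolution_length:
  fixes I :: "('v, 'k::field) mpoly set"
  assumes res: "has_free_resolution V I n" and I: "is_ideal V I"
    and C: "finite C" "C \<subseteq> V" and u: "u \<in> polys V" "u \<notin> I" "\<And>c. c \<in> C \<Longrightarrow> Var c * u \<in> I"
  shows "card C \<le> n"
proof -
  obtain r g d where cx: "exact_complex V r d" and r0: "\<And>i. n < i \<Longrightarrow> r i = 0"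
    and g: "\<forall>j<r 0. g j \<in> polys V" "\<And>p. p \<in> polys V \<Longrightarrow> \<exists>x\<in>fvec V (r 0). p - dot (r 0) x g \<in> I"
    and im: "{x \<in> fvec V (r 0). dot (r 0) x g \<in> I}
      = matvec (r 0) (r (Suc 0)) (d 0) ` fvec V (r (Suc 0))"
    by (rule has_free_resolution_exact_complex[OF res], rule that)
  interpret exact_complex V r d by (rule cx)
  obtain f where f: "f \<in> fvec V (r 0)" "u - dot (r 0) f g \<in> I" using g(2)[OF u(1)] by blast
  have "r (0 + card (C - {})) \<noteq> 0"
  proof (rule socle_shift[OF C _ _ f(1)])
    show "f - bd 0 w \<notin> mono_vec V (\<lambda>S. {} \<inter> S \<noteq> {}) (r 0)" if "w \<in> fvec V (r (Suc 0))" for w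
    proof
      assume "f - bd 0 w \<in> mono_vec V (\<lambda>S. {} \<inter> S \<noteq> {}) (r 0)"
      then have "f = bd 0 w" unfolding mono_vec_False by simp
      then have "dot (r 0) f g \<in> I" using im that by blast
      then have "(u - dot (r 0) f g) + dot (r 0) f g \<in> I" by (intro ideal_add[OF I] f(2))
      then show False using u(2) by simp
    qed
    show "\<exists>w\<in>fvec V (r (Suc 0)). Var c *v f - bd 0 w \<in> mono_vec V (\<lambda>S. {} \<inter> S \<noteq> {}) (r 0)"
      if "c \<in> C - {}" for c
    proof -
      have cV: "Var c \<in> polys V" using that C by auto
      have "Var c * u - Var c * (u - dot (r 0) f g) \<in> I"
        using that by (intro ideal_diff[OF I] u(3) ideal_mult[OF I] f(2) cV) auto
      then have "dot (r 0) (Var c *v f) g \<in> I"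
        by (simp add: dot_smul right_diff_distrib)
      moreover have "Var c *v f \<in> fvec V (r 0)" by (intro fvec_smul cV f)
      ultimately have "Var c *v f \<in> bd 0 ` fvec V (r (Suc 0))" using im by blast
      then obtain w where "w \<in> fvec V (r (Suc 0))" "Var c *v f = bd 0 w" by blast
      then show ?thesis by (intro bexI[of _ w]) (simp_all only: mono_vec_False diff_self insertI1)
    qed
  qed (auto intro: exact_mod_empty)
  then have "r (card C) \<noteq> 0" by simp
  then show ?thesis using r0[of "card C"] by fastforce
qed

section \<open>Existence of resolutions\<close>

text \<open>\<^term>\<open>syz_res V n r N\<close>: the quotient of the free module of rank \<^term>\<open>r\<close> by the submodule
  \<^term>\<open>N\<close> has a free resolution of length \<^term>\<open>n\<close> that starts with this free module.\<close>

primrec syz_res :: "'v set \<Rightarrow> nat \<Rightarrow> nat \<Rightarrow> (nat \<Rightarrow> ('v, 'k::field) mpoly) set \<Rightarrow> bool" where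
  "syz_res V 0 r N \<longleftrightarrow> N = {0}"
| "syz_res V (Suc n) r N \<longleftrightarrow> (\<exists>s A. (\<forall>a<r. \<forall>b<s. A a b \<in> polys V) \<and>
     N = matvec r s A ` fvec V s \<and> syz_res V n s {y \<in> fvec V s. matvec r s A y = 0})"

lemma syz_res_Suc: "syz_res V n r N \<Longrightarrow> syz_res V (Suc n) r N"
proof (induction n arbitrary: r N)
  case 0
  \<comment> \<open>The zero submodule is the image of the free module of rank 0, whose kernel is
    zero as well.\<close>
  then show ?case by (auto intro!: exI[of _ 0])
next
  case (Suc n)
  obtain s A where A: "\<forall>a<r. \<forall>b<s. A a b \<in> polys V" "N = matvec r s A ` fvec V s"
    and ker: "syz_res V n s {y \<in> fvec V s. matvec r s A y = 0}"
    using Suc.prems[unfolded syz_res.simps(2)[of V n]] by (elim exE conjE)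
  show ?case
    unfolding syz_res.simps(2)[of V "Suc n"]
    by (intro exI[of _ s] exI[of _ A] conjI A Suc.IH ker)
qed

text \<open>Unrolls the recursion into sequences of ranks and matrices as in
  \<open>has_free_resolution\<close>: the outermost rank and matrix go in front, and the resolution
  of the kernel moves up by one index.\<close>

lemma syz_res_chain:
  assumes "syz_res V n s N"
  shows "\<exists>r d. r 0 = s \<and> (\<forall>i. 1 \<le> i \<and> i \<le> n \<longrightarrow> (\<forall>a<r (i - 1). \<forall>b<r i. d i a b \<in> polys V)) \<and>
    N = (if n = 0 then {0} else matvec (r 0) (r 1) (d 1) ` fvec V (r 1)) \<and>
    (\<forall>i. 1 \<le> i \<and> i \<le> n \<longrightarrow> {x \<in> fvec V (r i). matvec (r (i - 1)) (r i) (d i) x = 0}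
      = (if i = n then {0} else matvec (r i) (r (i + 1)) (d (i + 1)) ` fvec V (r (i + 1))))"
  using assms
proof (induction n arbitrary: s N)
  case 0
  then show ?case by (intro exI[of _ "\<lambda>_. s"]) simp
next
  case (Suc n)
  then obtain t A where A: "\<forall>a<s. \<forall>b<t. A a b \<in> polys V" "N = matvec s t A ` fvec V t"
    and ker: "syz_res V n t {y \<in> fvec V t. matvec s t A y = 0}" by auto
  obtain r d where r0: "r 0 = t"
    and d: "\<And>i. 1 \<le> i \<Longrightarrow> i \<le> n \<Longrightarrow> \<forall>a<r (i - 1). \<forall>b<r i. d i a b \<in> polys V"
    and ex0: "{y \<in> fvec V t. matvec s t A y = 0}
      = (if n = 0 then {0} else matvec (r 0) (r 1) (d 1) ` fvec V (r 1))"
    and ex: "\<And>i. 1 \<le> i \<Longrightarrow> i \<le> n \<Longrightarrow> {x \<in> fvec V (r i). matvec (r (i - 1)) (r i) (d i) x = 0}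
      = (if i = n then {0} else matvec (r i) (r (i + 1)) (d (i + 1)) ` fvec V (r (i + 1)))"
    using Suc.IH[OF ker] by blast
  define r' where "r' = case_nat s r"
  define d' where "d' i = (if i = 1 then A else d (i - 1))" for i
  have r': "r' 0 = s" "r' (Suc i) = r i" for i by (simp_all add: r'_def)
  have d': "d' (Suc 0) = A" "d' (Suc (Suc i)) = d (Suc i)" for i by (simp_all add: d'_def)
  show ?case
  proof (intro exI[of _ r'] exI[of _ d'] conjI allI impI)
    show "r' 0 = s" by (rule r')
    show "N = (if Suc n = 0 then {0} else matvec (r' 0) (r' 1) (d' 1) ` fvec V (r' 1))"
      by (simp add: A r' d' r0)
  next
    fix i a b assume i: "1 \<le> i \<and> i \<le> Suc n" and ab: "a < r' (i - 1)" "b < r' i"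
    show "d' i a b \<in> polys V"
    proof (cases "i = 1")
      case True
      then show ?thesis using A ab by (simp add: r' d' r0)
    next
      case False
      then obtain j where "i = Suc (Suc j)" using i by (metis One_nat_def not0_implies_Suc not_one_le_zero)
      then show ?thesis using d[of "Suc j"] i ab by (simp add: r' d')
    qed
  next
    fix i assume i: "1 \<le> i \<and> i \<le> Suc n"
    show "{x \<in> fvec V (r' i). matvec (r' (i - 1)) (r' i) (d' i) x = 0}
      = (if i = Suc n then {0} else matvec (r' i) (r' (i + 1)) (d' (i + 1)) ` fvec V (r' (i + 1)))"
    proof (cases "i = 1")
      case True
      then show ?thesis using ex0 by (simp add: r' d' r0)
    next
      case False
      then obtain j where "i = Suc (Suc j)" using i by (metis One_nat_def not0_implies_Suc not_one_le_zero)
      then show ?thesis using ex[of "Suc j"] i by (simp add: r' d')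
    qed
  qed
qed

text \<open>Recursive counterpart of \<open>has_free_resolution\<close>: an augmentation onto S/J
  together with a resolution of its kernel, a form suited to gluing.\<close>

definition pd_le :: "'v set \<Rightarrow> nat \<Rightarrow> ('v, 'k::field) mpoly set \<Rightarrow> bool" where
  "pd_le V n J \<longleftrightarrow> (\<exists>r g. (\<forall>j<r. g j \<in> polys V) \<and>
     (\<forall>p\<in>polys V. \<exists>x\<in>fvec V r. p - dot r x g \<in> J) \<and>
     syz_res V n r {x \<in> fvec V r. dot r x g \<in> J})"

lemma pd_le_has_free_resolution:
  assumes "pd_le V n J"
  shows "has_free_resolution V J n"
proof -
  obtain s g where g: "\<forall>j<s. g j \<in> polys V" "\<forall>p\<in>polys V. \<exists>x\<in>fvec V s. p - dot s x g \<in> J"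
    and "syz_res V n s {x \<in> fvec V s. dot s x g \<in> J}"
    using assms unfolding pd_le_def by blast
  from syz_res_chain[OF this(3)] obtain r d where "r 0 = s"
    "(\<forall>i. 1 \<le> i \<and> i \<le> n \<longrightarrow> (\<forall>a<r (i - 1). \<forall>b<r i. d i a b \<in> polys V)) \<and>
    {x \<in> fvec V s. dot s x g \<in> J} = (if n = 0 then {0} else matvec (r 0) (r 1) (d 1) ` fvec V (r 1)) \<and>
    (\<forall>i. 1 \<le> i \<and> i \<le> n \<longrightarrow> {x \<in> fvec V (r i). matvec (r (i - 1)) (r i) (d i) x = 0}
      = (if i = n then {0} else matvec (r i) (r (i + 1)) (d (i + 1)) ` fvec V (r (i + 1))))"
    by blast
  with g show ?thesis
    unfolding has_free_resolution_def dot_def[symmetric] zero_fun_def[symmetric]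
    by (intro exI[of _ r] exI[of _ g] exI[of _ d]) simp
qed

lemma pd_le_Suc: "pd_le V n J \<Longrightarrow> pd_le V (Suc n) J"
  unfolding pd_le_def using syz_res_Suc by blast

lemma pd_le_mono: "pd_le V n J \<Longrightarrow> n \<le> m \<Longrightarrow> pd_le V m J"
  by (induction m) (auto simp: le_Suc_eq intro: pd_le_Suc)

section \<open>Direct sums, block matrices and the horseshoe lemma\<close>

definition joinv :: "nat \<Rightarrow> (nat \<Rightarrow> 'a) \<Rightarrow> (nat \<Rightarrow> 'a) \<Rightarrow> nat \<Rightarrow> 'a" where
  "joinv a x y i = (if i < a then x i else y (i - a))"

lemma joinv_add: "joinv a x y + joinv a x' y' = joinv a (x + x') (y + y')"
  and joinv_diff: "joinv a u w - joinv a u' w' = joinv a (u - u') (w - w')"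
  and joinv_zero: "joinv a 0 0 = 0"
  by (auto simp: joinv_def fun_eq_iff)

lemma joinv_fvec: "x \<in> fvec V a \<Longrightarrow> y \<in> fvec V c \<Longrightarrow> joinv a x y \<in> fvec V (a + c)"
  by (auto simp: joinv_def fvec_def)

lemma joinv_eq_0_iff:
  assumes "x \<in> fvec V a"
  shows "joinv a x y = 0 \<longleftrightarrow> x = 0 \<and> y = 0"
proof
  assume "joinv a x y = 0"
  then have z: "joinv a x y i = 0" for i by simp
  have "x i = 0" for i using z[of i] assms by (cases "i < a") (auto simp: joinv_def fvec_def)
  moreover have "y i = 0" for i using z[of "a + i"] by (simp add: joinv_def)
  ultimately show "x = 0 \<and> y = 0" by (simp add: fun_eq_iff)
qed (simp add: joinv_zero)

lemma fvec_joinv: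
  assumes "z \<in> fvec V (a + c)"
  obtains x y where "x \<in> fvec V a" "y \<in> fvec V c" "z = joinv a x y"
proof
  show "(\<lambda>i. if i < a then z i else 0) \<in> fvec V a" "(\<lambda>i. z (a + i)) \<in> fvec V c"
    "z = joinv a (\<lambda>i. if i < a then z i else 0) (\<lambda>i. z (a + i))"
    using assms by (auto simp: fvec_def joinv_def)
qed

lemma sum_lessThan_add: "(\<Sum>j<s + t. f j) = (\<Sum>j<s. f j) + (\<Sum>j<t. f (s + j) :: 'a::comm_monoid_add)"
  for s t :: nat
  by (induction t) (auto simp: add_ac)

lemma dot_joinv: "dot (a + c) (joinv a x y) (joinv a g h) = dot a x g + dot c y h"
  by (simp add: dot_def sum_lessThan_add joinv_def)

text \<open>The block upper triangular matrix with block rows (A, X) and (0, C).\<close>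

definition block_mat :: "nat \<Rightarrow> nat \<Rightarrow> (nat \<Rightarrow> nat \<Rightarrow> 'a::zero) \<Rightarrow> (nat \<Rightarrow> nat \<Rightarrow> 'a) \<Rightarrow> (nat \<Rightarrow> nat \<Rightarrow> 'a)
    \<Rightarrow> nat \<Rightarrow> nat \<Rightarrow> 'a" where
  "block_mat a s A X C i j =
    (if j < s then if i < a then A i j else 0
     else if i < a then X i (j - s) else C (i - a) (j - s))"

lemma matvec_block_mat:
  "matvec (a + c) (s + t) (block_mat a s A X C) (joinv s v w)
    = joinv a (matvec a s A v + matvec a t X w) (matvec c t C w)"
  by (auto simp: fun_eq_iff matvec_def sum_lessThan_add block_mat_def joinv_def)

definition submod :: "'v set \<Rightarrow> (nat \<Rightarrow> ('v, 'k::field) mpoly) set \<Rightarrow> bool" where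
  "submod V N \<longleftrightarrow> 0 \<in> N \<and> (\<forall>x\<in>N. \<forall>y\<in>N. x + y \<in> N) \<and> (\<forall>x\<in>N. \<forall>y\<in>N. x - y \<in> N) \<and>
     (\<forall>c\<in>polys V. \<forall>x\<in>N. c *v x \<in> N)"

lemma submodD:
  assumes "submod V N"
  shows submod_zero: "0 \<in> N"
    and submod_add: "x \<in> N \<Longrightarrow> y \<in> N \<Longrightarrow> x + y \<in> N"
    and submod_diff: "x \<in> N \<Longrightarrow> y \<in> N \<Longrightarrow> x - y \<in> N"
    and submod_smul: "c \<in> polys V \<Longrightarrow> x \<in> N \<Longrightarrow> c *v x \<in> N"
  using assms by (auto simp: submod_def)

lemma submod_kernel: "submod V {y \<in> fvec V s. matvec r s A y = 0}"
  unfolding submod_def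
  by (auto simp: matvec_add matvec_diff matvec_smul fvec_add fvec_diff fvec_smul)

lemma submod_dot: "is_ideal V J \<Longrightarrow> submod V {x \<in> fvec V r. dot r x g \<in> J}"
  unfolding submod_def
  by (auto simp: dot_add dot_diff dot_smul fvec_add fvec_diff fvec_smul
      ideal_zero ideal_add ideal_diff ideal_mult)

lemma submod_lincomb:
  fixes t :: nat
  assumes "submod V N" "\<And>j. j < t \<Longrightarrow> w j \<in> polys V" "\<And>j. j < t \<Longrightarrow> z j \<in> N"
  shows "(\<lambda>i. \<Sum>j<t. w j * z j i) \<in> N"
  using assms(2,3)
proof (induction t)
  case 0
  then show ?case using submod_zero[OF assms(1)] by (simp add: zero_fun_def)
next
  case (Suc t)
  have "(\<lambda>i. \<Sum>j<t. w j * z j i) + w t *v z t \<in> N"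
    using Suc by (intro submod_add[OF assms(1)] submod_smul[OF assms(1)]) auto
  then show ?case by (simp add: plus_fun_def)
qed

text \<open>The horseshoe lemma: the resolutions of the submodule of vectors supported on the first
  \<^term>\<open>a\<close> coordinates and of the quotient by it are glued by lifting the generators of the latter.\<close>

lemma horseshoe:
  assumes "submod V N" "N \<subseteq> fvec V (a + c)"
    and "syz_res V n a {x \<in> fvec V a. joinv a x 0 \<in> N}"
    and "syz_res V n c {y \<in> fvec V c. \<exists>x\<in>fvec V a. joinv a x y \<in> N}"
  shows "syz_res V n (a + c) N"
  using assms
proof (induction n arbitrary: a c N)
  case 0
  have "z = 0" if z: "z \<in> N" for z
  proof -
    obtain x y where xy: "x \<in> fvec V a" "y \<in> fvec V c" "z = joinv a x y"
      using fvec_joinv 0(2) z by blast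
    have "y \<in> {0}"
      unfolding "0.prems"(4)[unfolded syz_res.simps(1), symmetric] using xy z by blast
    then have y: "y = 0" by simp
    have "x \<in> {0}"
      unfolding "0.prems"(3)[unfolded syz_res.simps(1), symmetric] using xy z y by blast
    then show ?thesis using xy y by (simp add: joinv_zero)
  qed
  then show ?case using submod_zero[OF 0(1)] by auto
next
  case (Suc n)
  note sub = Suc.prems(1)
  obtain s A where A: "\<forall>i<a. \<forall>j<s. A i j \<in> polys V"
    and imA: "{x \<in> fvec V a. joinv a x 0 \<in> N} = matvec a s A ` fvec V s"
    and kerA: "syz_res V n s {y \<in> fvec V s. matvec a s A y = 0}"
    using Suc.prems(3)[unfolded syz_res.simps] by (elim exE conjE)
  obtain t C where C: "\<forall>i<c. \<forall>j<t. C i j \<in> polys V"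
    and imC: "{y \<in> fvec V c. \<exists>x\<in>fvec V a. joinv a x y \<in> N} = matvec c t C ` fvec V t"
    and kerC: "syz_res V n t {y \<in> fvec V t. matvec c t C y = 0}"
    using Suc.prems(4)[unfolded syz_res.simps] by (elim exE conjE)
  \<comment> \<open>The image of a unit vector under \<open>C\<close>, hence the second block of
    some element of \<open>N\<close>. The first blocks of such lifts form the columns of
    \<open>X\<close>.\<close>
  define col where "col j = (\<lambda>i. if i < c then C i j else 0)" for j
  have "\<exists>x\<in>fvec V a. joinv a x (col j) \<in> N" if j: "j < t" for j
  proof -
    have "(\<lambda>i. if i = j then 1 else 0) \<in> fvec V t" using j by (auto simp: fvec_def)
    moreover have "matvec c t C (\<lambda>i. if i = j then 1 else 0) = col j"
      using j by (auto simp: col_def matvec_def fun_eq_iff if_distrib sum.delta' cong: if_cong)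
    ultimately have "col j \<in> matvec c t C ` fvec V t" by (metis imageI)
    then show ?thesis unfolding imC[symmetric] by blast
  qed
  then obtain xx where xx: "\<And>j. j < t \<Longrightarrow> xx j \<in> fvec V a"
    "\<And>j. j < t \<Longrightarrow> joinv a (xx j) (col j) \<in> N" by metis
  define X where "X i j = xx j i" for i j
  have X: "\<forall>i<a. \<forall>j<t. X i j \<in> polys V" using xx(1) by (auto simp: X_def fvec_def)
  have lift: "joinv a (matvec a t X w) (matvec c t C w) \<in> N" if w: "w \<in> fvec V t" for w
  proof -
    have "(\<lambda>i. \<Sum>j<t. w j * joinv a (xx j) (col j) i) \<in> N"
      using w xx(2) by (intro submod_lincomb[OF sub]) (auto simp: fvec_def)
    also have "(\<lambda>i. \<Sum>j<t. w j * joinv a (xx j) (col j) i)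
        = joinv a (matvec a t X w) (matvec c t C w)"
      by (auto simp: fun_eq_iff joinv_def matvec_def X_def col_def mult.commute)
    finally show ?thesis .
  qed
  have Av: "matvec a s A v \<in> fvec V a \<and> joinv a (matvec a s A v) 0 \<in> N" if "v \<in> fvec V s" for v
    using imA that by blast
  have Xw: "matvec a t X w \<in> fvec V a" if "w \<in> fvec V t" for w
    using X that by (intro matvec_fvec) auto
  let ?M = "block_mat a s A X C"
  have "N = matvec (a + c) (s + t) ?M ` fvec V (s + t)"
  proof (intro equalityI subsetI)
    fix z assume z: "z \<in> N"
    then obtain x y where xy: "x \<in> fvec V a" "y \<in> fvec V c" "z = joinv a x y"
      using fvec_joinv Suc.prems(2) by blast
    then have "y \<in> matvec c t C ` fvec V t" unfolding imC[symmetric] using z by blast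
    then obtain w where w: "w \<in> fvec V t" "y = matvec c t C w" by blast
    \<comment> \<open>Subtracting the lift of the second block leaves an element of \<open>N\<close>
      supported on the first block, which \<open>A\<close> generates.\<close>
    have "z - joinv a (matvec a t X w) (matvec c t C w) \<in> N"
      by (intro submod_diff[OF sub] z lift w)
    then have "joinv a (x - matvec a t X w) 0 \<in> N"
      by (simp only: xy w joinv_diff diff_self)
    moreover have "x - matvec a t X w \<in> fvec V a" by (intro fvec_diff xy Xw w)
    ultimately have "x - matvec a t X w \<in> matvec a s A ` fvec V s" unfolding imA[symmetric] by blast
    then obtain v where v: "v \<in> fvec V s" "x - matvec a t X w = matvec a s A v" by blast
    have "x = matvec a s A v + matvec a t X w" using v(2)[symmetric] by simp
    then have "z = matvec (a + c) (s + t) ?M (joinv s v w)"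
      by (simp add: matvec_block_mat xy w)
    then show "z \<in> matvec (a + c) (s + t) ?M ` fvec V (s + t)"
      using joinv_fvec[OF v(1) w(1)] by blast
  next
    fix z assume "z \<in> matvec (a + c) (s + t) ?M ` fvec V (s + t)"
    then obtain u where u: "u \<in> fvec V (s + t)" "z = matvec (a + c) (s + t) ?M u" by blast
    obtain v w where v: "v \<in> fvec V s" and w: "w \<in> fvec V t" and "u = joinv s v w"
      by (rule fvec_joinv[OF u(1)])
    then have z: "z = matvec (a + c) (s + t) ?M (joinv s v w)" using u(2) by simp
    have "joinv a (matvec a s A v) 0 + joinv a (matvec a t X w) (matvec c t C w) \<in> N"
      using Av[OF v] lift[OF w] by (intro submod_add[OF sub]) auto
    then show "z \<in> N" by (simp add: z matvec_block_mat joinv_add)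
  qed
  moreover have "\<forall>i<a + c. \<forall>j<s + t. ?M i j \<in> polys V"
    using A X C by (auto simp: block_mat_def)
  moreover have "syz_res V n (s + t) {z \<in> fvec V (s + t). matvec (a + c) (s + t) ?M z = 0}"
    (is "syz_res V n (s + t) ?K")
  proof (rule Suc.IH[OF submod_kernel])
    have K: "joinv s v w \<in> ?K \<longleftrightarrow> matvec a s A v + matvec a t X w = 0 \<and> matvec c t C w = 0"
      if "v \<in> fvec V s" "w \<in> fvec V t" for v w
    proof -
      have "matvec a s A v + matvec a t X w \<in> fvec V a"
        using Av[OF that(1)] Xw[OF that(2)] by (intro fvec_add) auto
      then show ?thesis
        using that by (simp add: matvec_block_mat joinv_eq_0_iff joinv_fvec)
    qed
    have "{x \<in> fvec V s. joinv s x 0 \<in> ?K} = {y \<in> fvec V s. matvec a s A y = 0}"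
      using K[OF _ fvec_zero] by auto
    then show "syz_res V n s {x \<in> fvec V s. joinv s x 0 \<in> ?K}" using kerA by simp
    \<comment> \<open>The kernel of the block matrix projects onto the kernel of \<open>C\<close>:
      if \<open>C w = 0\<close>, the lift of \<open>w\<close> is supported on the first block, so
      \<open>X w\<close> is in the image of \<open>A\<close> and a preimage can be
      subtracted.\<close>
    have "\<exists>x\<in>fvec V s. joinv s x w \<in> ?K" if w: "w \<in> fvec V t" and Cw: "matvec c t C w = 0" for w
    proof -
      have "joinv a (matvec a t X w) 0 \<in> N" using lift[OF w] Cw by simp
      then have "matvec a t X w \<in> matvec a s A ` fvec V s"
        unfolding imA[symmetric] using Xw[OF w] by blast
      then obtain v where v: "v \<in> fvec V s" "matvec a t X w = matvec a s A v" by blast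
      have "0 - v \<in> fvec V s" by (intro fvec_diff fvec_zero v)
      moreover have "matvec a s A (0 - v) + matvec a t X w = 0"
        unfolding matvec_diff v(2) by simp
      ultimately show ?thesis using K[OF _ w] Cw by blast
    qed
    then have "{y \<in> fvec V t. \<exists>x\<in>fvec V s. joinv s x y \<in> ?K} = {y \<in> fvec V t. matvec c t C y = 0}"
      using K by blast
    then show "syz_res V n t {y \<in> fvec V t. \<exists>x\<in>fvec V s. joinv s x y \<in> ?K}" using kerC by simp
  qed auto
  ultimately show ?case
    unfolding syz_res.simps by (intro exI[of _ "s + t"] exI[of _ ?M] conjI)
qed

section \<open>Colon ideals, mapping cones and ideals of variables\<close>

text \<open>Multiplication by \<open>v\<close> embeds S/(J : v) into S/J with cokernel S/(J, v).
  Hence the generators of S/J are \<open>v\<close> times those of the colon quotient together with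
  those of the cokernel, and the relations on both blocks match the given ones.\<close>

lemma pd_le_colon:
  assumes J: "is_ideal V J" and v: "v \<in> polys V"
    and colon: "pd_le V n {p \<in> polys V. v * p \<in> J}"
    and quot: "pd_le V n {p \<in> polys V. \<exists>q\<in>polys V. p - v * q \<in> J}"
  shows "pd_le V n J"
proof -
  obtain a g where g: "\<forall>j<a. g j \<in> polys V"
    "\<And>p. p \<in> polys V \<Longrightarrow> \<exists>x\<in>fvec V a. p - dot a x g \<in> {p \<in> polys V. v * p \<in> J}"
    and resA: "syz_res V n a {x \<in> fvec V a. dot a x g \<in> {p \<in> polys V. v * p \<in> J}}"
    using colon unfolding pd_le_def by (elim exE conjE) blast
  obtain c h where h: "\<forall>j<c. h j \<in> polys V"
    "\<And>p. p \<in> polys V \<Longrightarrow> \<exists>x\<in>fvec V c. p - dot c x h \<in> {p \<in> polys V. \<exists>q\<in>polys V. p - v * q \<in> J}"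
    and resC: "syz_res V n c {x \<in> fvec V c. dot c x h \<in> {p \<in> polys V. \<exists>q\<in>polys V. p - v * q \<in> J}}"
    using quot unfolding pd_le_def by (elim exE conjE) blast
  let ?g = "joinv a (v *v g) h"
  let ?N = "{z \<in> fvec V (a + c). dot (a + c) z ?g \<in> J}"
  have dotN: "dot (a + c) (joinv a x y) ?g = v * dot a x g + dot c y h" for x y
    by (simp add: dot_joinv dot_smul_right)
  have "syz_res V n (a + c) ?N"
  proof (rule horseshoe[OF submod_dot[OF J]])
    have "{x \<in> fvec V a. joinv a x 0 \<in> ?N} = {x \<in> fvec V a. dot a x g \<in> {p \<in> polys V. v * p \<in> J}}"
      using joinv_fvec[OF _ fvec_zero] by (auto simp: dotN dot_polys g(1))
    then show "syz_res V n a {x \<in> fvec V a. joinv a x 0 \<in> ?N}" using resA by simp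
    have "(\<exists>x\<in>fvec V a. joinv a x y \<in> ?N) \<longleftrightarrow> (\<exists>q\<in>polys V. dot c y h - v * q \<in> J)"
      if y: "y \<in> fvec V c" for y
    proof
      assume "\<exists>x\<in>fvec V a. joinv a x y \<in> ?N"
      then obtain x where x: "x \<in> fvec V a" "v * dot a x g + dot c y h \<in> J" by (auto simp: dotN)
      then show "\<exists>q\<in>polys V. dot c y h - v * q \<in> J"
        by (intro bexI[of _ "- dot a x g"] polys_uminus dot_polys g(1)) (simp_all add: add.commute)
    next
      assume "\<exists>q\<in>polys V. dot c y h - v * q \<in> J"
      then obtain q where q: "q \<in> polys V" "dot c y h - v * q \<in> J" by blast
      obtain x where x: "x \<in> fvec V a" "v * (q - dot a x g) \<in> J" using g(2)[OF q(1)] by blast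
      have "(dot c y h - v * q) + v * (q - dot a x g) \<in> J" by (intro ideal_add[OF J] q x)
      then have "v * dot a (0 - x) g + dot c y h \<in> J"
        by (simp only: dot_diff) (simp add: algebra_simps)
      moreover have "0 - x \<in> fvec V a" by (intro fvec_diff fvec_zero x)
      ultimately show "\<exists>x\<in>fvec V a. joinv a x y \<in> ?N"
        using y by (intro bexI[of _ "0 - x"]) (simp_all only: dotN mem_Collect_eq joinv_fvec simp_thms)
    qed
    then have "{y \<in> fvec V c. \<exists>x\<in>fvec V a. joinv a x y \<in> ?N}
      = {y \<in> fvec V c. dot c y h \<in> {p \<in> polys V. \<exists>q\<in>polys V. p - v * q \<in> J}}"
      using dot_polys[OF _ h(1)] by blast
    then show "syz_res V n c {y \<in> fvec V c. \<exists>x\<in>fvec V a. joinv a x y \<in> ?N}" using resC by simp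
  qed blast
  moreover have "\<forall>j<a + c. ?g j \<in> polys V"
    using g(1) h(1) v by (auto simp: joinv_def intro: polys_mult)
  moreover have "\<exists>z\<in>fvec V (a + c). p - dot (a + c) z ?g \<in> J" if p: "p \<in> polys V" for p
  proof -
    obtain y q where y: "y \<in> fvec V c" "q \<in> polys V" "p - dot c y h - v * q \<in> J"
      using h(2)[OF p] by blast
    obtain x where x: "x \<in> fvec V a" "v * (q - dot a x g) \<in> J" using g(2)[OF y(2)] by blast
    have "(p - dot c y h - v * q) + v * (q - dot a x g) \<in> J" by (intro ideal_add[OF J] y x)
    then have "p - dot (a + c) (joinv a x y) ?g \<in> J"
      unfolding dotN by (simp add: algebra_simps)
    then show ?thesis using joinv_fvec[OF x(1) y(1)] by blast
  qed
  ultimately show ?thesis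
    unfolding pd_le_def by (intro exI[of _ "a + c"] exI[of _ ?g] conjI) blast+
qed

text \<open>The matrix is \<open>A\<close> followed by \<open>v\<close> times the identity; its
  columns generate the relations modulo J + (v) when those of \<open>A\<close> generate the
  relations modulo J.\<close>

lemma matvec_augmented:
  assumes "w \<in> fvec V r"
  shows "matvec r (s + r) (\<lambda>i j. if j < s then A i j else if j - s = i then v else 0) (joinv s y w)
    = matvec r s A y + v *v w"
proof
  fix i
  have "(\<Sum>j<r. (if j = i then v else 0) * w j) = (\<Sum>j<r. if j = i then v * w j else 0)"
    by (intro sum.cong) auto
  also have "\<dots> = (if i < r then v * w i else 0)" by simp
  finally show "matvec r (s + r) (\<lambda>i j. if j < s then A i j else if j - s = i then v else 0) (joinv s y w) i
      = (matvec r s A y + v *v w) i"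
    using assms by (auto simp: matvec_def sum_lessThan_add joinv_def fvec_def)
qed

text \<open>The mapping cone of multiplication by a non-zero-divisor \<^term>\<open>v\<close> modulo \<^term>\<open>J\<close>.\<close>

lemma pd_le_cone:
  assumes J: "is_ideal V J" and v: "v \<in> polys V"
    and pd: "pd_le V n J" and reg: "\<And>p. p \<in> polys V \<Longrightarrow> v * p \<in> J \<Longrightarrow> p \<in> J"
  shows "pd_le V (Suc n) {p \<in> polys V. \<exists>q\<in>polys V. p - v * q \<in> J}" (is "pd_le V _ ?J'")
proof -
  obtain r g where g: "\<forall>j<r. g j \<in> polys V" "\<And>p. p \<in> polys V \<Longrightarrow> \<exists>x\<in>fvec V r. p - dot r x g \<in> J"
    and res: "syz_res V n r {x \<in> fvec V r. dot r x g \<in> J}" (is "syz_res V n r ?N")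
    using pd unfolding pd_le_def by (elim exE conjE) blast
  \<comment> \<open>Lengthening the resolution by a zero module yields a presentation matrix even
    for \<open>n = 0\<close>, with its kernel still resolved in length \<open>n\<close>.\<close>
  obtain s A where A: "\<forall>i<r. \<forall>j<s. A i j \<in> polys V" and im: "?N = matvec r s A ` fvec V s"
    and ker: "syz_res V n s {y \<in> fvec V s. matvec r s A y = 0}"
    using syz_res_Suc[OF res, unfolded syz_res.simps(2)[of V n]] by (elim exE conjE)
  let ?M = "\<lambda>i j. if j < s then A i j else if j - s = i then v else 0"
  note M = matvec_augmented[where A = A and v = v]
  have "{x \<in> fvec V r. dot r x g \<in> ?J'} = matvec r (s + r) ?M ` fvec V (s + r)"
  proof (intro equalityI subsetI)
    fix x assume "x \<in> {x \<in> fvec V r. dot r x g \<in> ?J'}"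
    then obtain q where x: "x \<in> fvec V r" and q: "q \<in> polys V" "dot r x g - v * q \<in> J" by blast
    obtain w where w: "w \<in> fvec V r" "q - dot r w g \<in> J" using g(2)[OF q(1)] by blast
    have "(dot r x g - v * q) + v * (q - dot r w g) \<in> J"
      by (intro ideal_add[OF J] q ideal_mult[OF J] w v)
    then have "dot r (x - v *v w) g \<in> J"
      by (simp only: dot_diff dot_smul) (simp add: algebra_simps)
    moreover have "x - v *v w \<in> fvec V r" by (intro fvec_diff x fvec_smul v w)
    ultimately have "x - v *v w \<in> matvec r s A ` fvec V s" unfolding im[symmetric] by blast
    then obtain y where y: "y \<in> fvec V s" "x - v *v w = matvec r s A y" by blast
    have "x = matvec r (s + r) ?M (joinv s y w)"
      unfolding M[OF w(1)] y(2)[symmetric] by simp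
    then show "x \<in> matvec r (s + r) ?M ` fvec V (s + r)" using joinv_fvec[OF y(1) w(1)] by blast
  next
    fix x assume "x \<in> matvec r (s + r) ?M ` fvec V (s + r)"
    then obtain u where u: "u \<in> fvec V (s + r)" "x = matvec r (s + r) ?M u" by blast
    obtain y w where y: "y \<in> fvec V s" and w: "w \<in> fvec V r" and "u = joinv s y w"
      by (rule fvec_joinv[OF u(1)])
    then have x: "x = matvec r s A y + v *v w" using u(2) M[OF w] by simp
    have Ay: "matvec r s A y \<in> ?N" unfolding im using y by blast
    have xf: "x \<in> fvec V r" unfolding x using Ay by (intro fvec_add fvec_smul v w) blast
    have "dot r x g - v * dot r w g \<in> J" using Ay unfolding x dot_add dot_smul by simp
    then show "x \<in> {x \<in> fvec V r. dot r x g \<in> ?J'}"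
      using xf dot_polys[OF xf g(1)] dot_polys[OF w g(1)] by blast
  qed
  moreover have "\<forall>i<r. \<forall>j<s + r. ?M i j \<in> polys V" using A v by auto
  moreover have "syz_res V n (s + r) {z \<in> fvec V (s + r). matvec r (s + r) ?M z = 0}"
    (is "syz_res V n (s + r) ?K")
  proof (rule horseshoe[OF submod_kernel])
    have K: "joinv s y w \<in> ?K \<longleftrightarrow> matvec r s A y + v *v w = 0"
      if "y \<in> fvec V s" "w \<in> fvec V r" for y w
      using M[OF that(2)] joinv_fvec[OF that] by simp
    have "joinv s y 0 \<in> ?K \<longleftrightarrow> matvec r s A y = 0" if "y \<in> fvec V s" for y
      unfolding K[OF that fvec_zero] by simp
    then have "{y \<in> fvec V s. joinv s y 0 \<in> ?K} = {y \<in> fvec V s. matvec r s A y = 0}" by blast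
    then show "syz_res V n s {y \<in> fvec V s. joinv s y 0 \<in> ?K}" using ker by simp
    \<comment> \<open>The kernel projects onto \<open>?N\<close> itself, because \<open>v\<close>
      times \<open>dot r w g\<close> lies in \<open>J\<close> and regularity cancels
      \<open>v\<close>. The resolution of \<open>?N\<close> is thus used a second time.\<close>
    have "(\<exists>y\<in>fvec V s. joinv s y w \<in> ?K) \<longleftrightarrow> dot r w g \<in> J" if w: "w \<in> fvec V r" for w
    proof
      assume "\<exists>y\<in>fvec V s. joinv s y w \<in> ?K"
      then obtain y where y: "y \<in> fvec V s" "matvec r s A y + v *v w = 0" using K[OF _ w] by blast
      have "matvec r s A y \<in> ?N" unfolding im using y by blast
      moreover have "dot r (matvec r s A y) g + v * dot r w g = 0"
        using arg_cong[OF y(2), of "\<lambda>x. dot r x g"] unfolding dot_add dot_smul dot_zero .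
      then have "v * dot r w g = 0 - dot r (matvec r s A y) g" by (simp add: eq_neg_iff_add_eq_0 add.commute)
      ultimately have "v * dot r w g \<in> J" using ideal_diff[OF J ideal_zero[OF J]] by simp
      then show "dot r w g \<in> J" by (rule reg[OF dot_polys[OF w g(1)]])
    next
      assume "dot r w g \<in> J"
      then have "dot r (v *v w) g \<in> J" unfolding dot_smul by (intro ideal_mult[OF J] v)
      moreover have "v *v w \<in> fvec V r" by (intro fvec_smul v w)
      ultimately have "v *v w \<in> matvec r s A ` fvec V s" unfolding im[symmetric] by blast
      then obtain y where y: "y \<in> fvec V s" "v *v w = matvec r s A y" by blast
      have "matvec r s A (0 - y) + v *v w = 0" unfolding matvec_diff y(2) by simp
      moreover have "0 - y \<in> fvec V s" by (intro fvec_diff fvec_zero y)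
      ultimately show "\<exists>y\<in>fvec V s. joinv s y w \<in> ?K" using K[OF _ w] by blast
    qed
    then have "{w \<in> fvec V r. \<exists>y\<in>fvec V s. joinv s y w \<in> ?K} = ?N" by blast
    then show "syz_res V n r {w \<in> fvec V r. \<exists>y\<in>fvec V s. joinv s y w \<in> ?K}" using res by simp
  qed blast
  ultimately have "syz_res V (Suc n) r {x \<in> fvec V r. dot r x g \<in> ?J'}"
    unfolding syz_res.simps by (intro exI[of _ "s + r"] exI[of _ ?M] conjI)
  moreover have "\<exists>x\<in>fvec V r. p - dot r x g \<in> ?J'" if p: "p \<in> polys V" for p
  proof -
    obtain x where x: "x \<in> fvec V r" "p - dot r x g \<in> J" using g(2)[OF p] by blast
    then have "p - dot r x g - v * 0 \<in> J" by simp
    then show ?thesis using x ideal_polys[OF J x(2)] polys_zero by blast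
  qed
  ultimately show ?thesis
    unfolding pd_le_def using g(1) by (intro exI[of _ r] exI[of _ g] conjI) blast+
qed

lemma mono_ideal_colon_Var:
  "v \<in> V \<Longrightarrow> {p \<in> polys V. Var v * p \<in> mono_ideal V Q} = mono_ideal V (\<lambda>S. Q (insert v S))"
  by (auto simp: Var_mult_mem_mono_ideal mono_ideal_polys)

lemma mono_ideal_plus_Var:
  "v \<in> V \<Longrightarrow> {p \<in> polys V. \<exists>q\<in>polys V. p - Var v * q \<in> mono_ideal V Q}
    = mono_ideal V (\<lambda>S. Q S \<or> v \<in> S)"
  using mono_ideal_add_Var[of v V _ Q] mono_ideal_polys by blast

text \<open>A variable outside \<open>D\<close> is regular modulo the variables in \<open>D\<close>,
  so iterated mapping cones, as in the Koszul complex, add one step per variable.\<close>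

lemma pd_le_variables:
  assumes "finite D" "D \<subseteq> V"
  shows "pd_le V (card D) (mono_ideal V (\<lambda>S. D \<inter> S \<noteq> {}) :: ('v, 'k::field) mpoly set)"
  using assms
proof (induction D rule: finite_induct)
  case empty
  have I: "mono_ideal V (\<lambda>S. {} \<inter> S \<noteq> {}) = {0 :: ('v, 'k) mpoly}"
    by (auto simp: mono_ideal_def polys_def)
  \<comment> \<open>Without variables the quotient is S, free on the single generator 1.\<close>
  have "{x \<in> fvec V 1. dot 1 x 1 \<in> {0}} = {0 :: nat \<Rightarrow> ('v, 'k) mpoly}"
    by (auto simp: dot_def fvec_def fun_eq_iff less_Suc_eq_0_disj)
      (metis One_nat_def less_one linorder_not_le)
  moreover have "\<exists>x\<in>fvec V 1. p - dot 1 x 1 \<in> {0}" if "p \<in> polys V" for p :: "('v, 'k) mpoly"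
    using that by (intro bexI[of _ "\<lambda>j. if j = 0 then p else 0"]) (auto simp: dot_def fvec_def)
  ultimately show ?case
    unfolding pd_le_def I by (intro exI[of _ 1] conjI) auto
next
  case (insert d D)
  have d: "d \<in> V" using insert.prems by simp
  have "pd_le V (Suc (card D)) {p \<in> polys V. \<exists>q\<in>polys V.
      p - Var d * q \<in> (mono_ideal V (\<lambda>S. D \<inter> S \<noteq> {}) :: ('v, 'k) mpoly set)}"
  proof (rule pd_le_cone)
    show "pd_le V (card D) (mono_ideal V (\<lambda>S. D \<inter> S \<noteq> {}) :: ('v, 'k) mpoly set)"
      using insert by simp
    show "p \<in> mono_ideal V (\<lambda>S. D \<inter> S \<noteq> {})" if "Var d * p \<in> mono_ideal V (\<lambda>S. D \<inter> S \<noteq> {})"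
      for p :: "('v, 'k) mpoly"
      using that insert.hyps by (simp add: Var_mult_mem_mono_ideal[OF d])
    show "is_ideal V (mono_ideal V (\<lambda>S. D \<inter> S \<noteq> {}) :: ('v, 'k) mpoly set)"
      by (rule is_ideal_mono_ideal[OF mono_meets])
    show "(Var d :: ('v, 'k) mpoly) \<in> polys V" by (rule Var_polys[OF d])
  qed
  moreover have "(\<lambda>S. insert d D \<inter> S \<noteq> {}) = (\<lambda>S. D \<inter> S \<noteq> {} \<or> d \<in> S)" by auto
  ultimately show ?case
    by (simp only: mono_ideal_plus_Var[OF d] card_insert_disjoint[OF insert.hyps(1,2)])
qed

section \<open>Edge ideals and maximal independent sets\<close>

text \<open>Describes the edge ideal of the graph on \<open>W\<close> plus the variables in
  \<open>D\<close>, a family of ideals closed under colon by and sum with a variable from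
  \<open>W\<close>.\<close>

definition meets_edge :: "('v \<Rightarrow> 'v \<Rightarrow> bool) \<Rightarrow> 'v set \<Rightarrow> 'v set \<Rightarrow> 'v set \<Rightarrow> bool" where
  "meets_edge adj W D S \<longleftrightarrow> D \<inter> S \<noteq> {} \<or> (\<exists>u\<in>W \<inter> S. \<exists>w\<in>W \<inter> S. adj u w)"

definition max_indep :: "('v \<Rightarrow> 'v \<Rightarrow> bool) \<Rightarrow> 'v set \<Rightarrow> 'v set \<Rightarrow> bool" where
  "max_indep adj W A \<longleftrightarrow> A \<subseteq> W \<and> (\<forall>a\<in>A. \<forall>b\<in>A. \<not> adj a b) \<and> (\<forall>w\<in>W - A. \<exists>a\<in>A. adj w a)"

lemma mono_meets_edge: "mono (meets_edge adj W D)"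
  by (auto simp: mono_def meets_edge_def)

text \<open>In a graph all of whose induced subgraphs with an edge have an edge \<^term>\<open>(u, v)\<close> such that
  \<^term>\<open>v\<close> dominates the neighbourhood of \<^term>\<open>u\<close> (for instance in a chordal graph), colon and
  sum with the variable of \<^term>\<open>v\<close> remove vertices without destroying the bound given by the
  sizes of maximal independent sets.\<close>

lemma pd_le_edge_ideal:
  assumes sym: "\<And>u w. adj u w \<Longrightarrow> adj w u" and irrefl: "\<And>u. \<not> adj u u"
    and dom: "\<And>W. W \<subseteq> V \<Longrightarrow> \<exists>u\<in>W. \<exists>w\<in>W. adj u w \<Longrightarrow>
      \<exists>u\<in>W. \<exists>v\<in>W. adj u v \<and> (\<forall>w\<in>W. adj u w \<longrightarrow> w = v \<or> adj v w)"
    and "finite V" "W \<subseteq> V" "D \<subseteq> V" "W \<inter> D = {}"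
    and "\<And>A. max_indep adj W A \<Longrightarrow> s \<le> card A" and "card D + card W \<le> n + s"
  shows "pd_le V n (mono_ideal V (meets_edge adj W D) :: ('v, 'k::field) mpoly set)"
  using assms(5-)
proof (induction "card W" arbitrary: W D s rule: less_induct)
  case less
  have finW: "finite W" and finD: "finite D"
    using less.prems \<open>finite V\<close> by (auto intro: finite_subset)
  show ?case
  proof (cases "\<exists>u\<in>W. \<exists>w\<in>W. adj u w")
    case False
    then have "max_indep adj W W" by (auto simp: max_indep_def)
    then have "card D \<le> n" using less.prems(4,5) by fastforce
    moreover have "meets_edge adj W D = (\<lambda>S. D \<inter> S \<noteq> {})"
      using False by (auto simp: meets_edge_def fun_eq_iff)
    ultimately show ?thesis
      using pd_le_mono[OF pd_le_variables[OF finD less.prems(2)]] by simp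
  next
    case True
    obtain u v where uv: "u \<in> W" "v \<in> W" "adj u v" "\<And>w. w \<in> W \<Longrightarrow> adj u w \<Longrightarrow> w = v \<or> adj v w"
      using dom[OF less.prems(1) True] by blast
    have vV: "v \<in> V" and vD: "v \<notin> D" using uv less.prems by auto
    define N where "N = {w \<in> W. adj v w}"
    have vN: "v \<notin> N" and NW: "N \<subseteq> W" using irrefl by (auto simp: N_def)
    have fN: "finite N" using NW finW finite_subset by blast
    have cardW: "card W = card (W - insert v N) + Suc (card N)"
    proof -
      have "card (insert v N) \<le> card W" using NW uv(2) finW by (intro card_mono) auto
      then show ?thesis
        using NW uv(2) fN vN by (simp add: card_Diff_subset)
    qed
    \<comment> \<open>In the colon ideal the neighbours of \<open>v\<close> become variables and
      \<open>v\<close> disappears, so the vertex count drops by one. Adding \<open>v\<close> to a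
      maximal independent set of the rest gives one of \<open>W\<close>, so the bound
      \<open>s\<close> drops by at most one.\<close>
    have colon: "pd_le V n (mono_ideal V (meets_edge adj (W - insert v N) (D \<union> N)) :: ('v, 'k) mpoly set)"
    proof (rule less.hyps)
      show "card (W - insert v N) < card W" using cardW by simp
      show "W - insert v N \<subseteq> V" "D \<union> N \<subseteq> V" "(W - insert v N) \<inter> (D \<union> N) = {}"
        using less.prems NW by auto
      have "card (D \<union> N) = card D + card N"
        using finD fN NW less.prems(3) by (intro card_Un_disjoint) auto
      then show "card (D \<union> N) + card (W - insert v N) \<le> n + (s - 1)"
        using cardW less.prems(5) by linarith
      fix A assume A: "max_indep adj (W - insert v N) A"
      have "max_indep adj W (insert v A)"
        using A uv(2) irrefl sym unfolding max_indep_def N_def by blast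
      moreover have "v \<notin> A" "finite A"
        using A finW by (auto simp: max_indep_def intro: finite_subset)
      ultimately show "s - 1 \<le> card A" using less.prems(4)[of "insert v A"] by simp
    qed
    have quot: "pd_le V n (mono_ideal V (meets_edge adj (W - {v}) (insert v D)) :: ('v, 'k) mpoly set)"
    proof (rule less.hyps)
      show "card (W - {v}) < card W" using uv finW by (intro psubset_card_mono) auto
      show "W - {v} \<subseteq> V" "insert v D \<subseteq> V" "(W - {v}) \<inter> insert v D = {}"
        using less.prems vV by auto
      show "card (insert v D) + card (W - {v}) \<le> n + s"
        using less.prems(5) finD finW vD uv(2) card_gt_0_iff[of W] by (auto simp: card_Diff_singleton)
      fix A assume A: "max_indep adj (W - {v}) A"
      \<comment> \<open>Domination enters here: \<open>A\<close> contains \<open>u\<close> or a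
        neighbour of \<open>u\<close>, and either is adjacent to \<open>v\<close>. So
        \<open>A\<close> stays maximal when \<open>v\<close> is put back.\<close>
      have "\<exists>a\<in>A. adj v a"
      proof (cases "u \<in> A")
        case True
        then show ?thesis using sym[OF uv(3)] by blast
      next
        case False
        then have "u \<in> W - {v} - A" using uv irrefl by auto
        then obtain a where "a \<in> A" "adj u a" using A unfolding max_indep_def by blast
        then show ?thesis using uv(4)[of a] A unfolding max_indep_def by blast
      qed
      then have "max_indep adj W A" using A unfolding max_indep_def by blast
      then show "s \<le> card A" by (rule less.prems(4))
    qed
    have "meets_edge adj W D (insert v S) = meets_edge adj (W - insert v N) (D \<union> N) S" for S
    proof
      assume "meets_edge adj W D (insert v S)"
      then show "meets_edge adj (W - insert v N) (D \<union> N) S"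
        using vD irrefl sym unfolding meets_edge_def N_def by blast
    next
      assume "meets_edge adj (W - insert v N) (D \<union> N) S"
      then show "meets_edge adj W D (insert v S)"
        using uv(2) unfolding meets_edge_def N_def by blast
    qed
    then have Q1: "(\<lambda>S. meets_edge adj W D (insert v S)) = meets_edge adj (W - insert v N) (D \<union> N)"
      by blast
    have "meets_edge adj W D S \<or> v \<in> S \<longleftrightarrow> meets_edge adj (W - {v}) (insert v D) S" for S
      unfolding meets_edge_def by blast
    then have Q2: "(\<lambda>S. meets_edge adj W D S \<or> v \<in> S) = meets_edge adj (W - {v}) (insert v D)"
      by blast
    show ?thesis
      by (rule pd_le_colon[OF is_ideal_mono_ideal[OF mono_meets_edge] Var_polys[OF vV]])
        (use colon quot in \<open>simp_all only: mono_ideal_colon_Var[OF vV] mono_ideal_plus_Var[OF vV] Q1 Q2\<close>)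
  qed
qed

text \<open>Minimality of \<open>A\<close> feeds the upper bound with \<open>s = card A\<close>. For
  the lower bound, the squarefree monomial with support \<open>A\<close> is nonzero modulo the ideal
  by independence and killed by all variables outside \<open>A\<close> by maximality.\<close>

theorem projdim_edge_ideal:
  assumes sym: "\<And>u w. adj u w \<Longrightarrow> adj w u" and irrefl: "\<And>u. \<not> adj u u"
    and dom: "\<And>W. W \<subseteq> V \<Longrightarrow> \<exists>u\<in>W. \<exists>w\<in>W. adj u w \<Longrightarrow>
      \<exists>u\<in>W. \<exists>v\<in>W. adj u v \<and> (\<forall>w\<in>W. adj u w \<longrightarrow> w = v \<or> adj v w)"
    and fin: "finite V" and A: "max_indep adj V A" and min: "\<And>B. max_indep adj V B \<Longrightarrow> card A \<le> card B"
  shows "projdim_quot V (mono_ideal V (meets_edge adj V {}) :: ('v, 'k::field) mpoly set)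
    = card V - card A"
  unfolding projdim_quot_def
proof (rule Least_equality)
  let ?I = "mono_ideal V (meets_edge adj V {}) :: ('v, 'k) mpoly set"
  have AV: "A \<subseteq> V" and fA: "finite A"
    using A fin by (auto simp: max_indep_def intro: finite_subset)
  have "card {} + card V \<le> card V - card A + card A" by simp
  then have "pd_le V (card V - card A) ?I"
    by (intro pd_le_edge_ideal[OF sym irrefl dom fin order.refl _ _ min]) auto
  then show "has_free_resolution V ?I (card V - card A)"
    by (rule pd_le_has_free_resolution)
  fix n assume n: "has_free_resolution V ?I n"
  define m :: "'v \<Rightarrow>\<^sub>0 nat" where "m = (\<Sum>a\<in>A. Poly_Mapping.single a 1)"
  have m: "supp m = A"
    using fA by (auto simp: m_def in_keys_iff lookup_sum lookup_single when_def split: if_splits)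
  let ?u = "Poly_Mapping.single m 1 :: ('v, 'k) mpoly"
  have "card (V - A) \<le> n"
  proof (rule card_le_resolution_length[OF n is_ideal_mono_ideal[OF mono_meets_edge]])
    show "?u \<in> polys V" using AV by (simp add: polys_def m)
    show "?u \<notin> ?I" using A by (auto simp: mono_ideal_def m meets_edge_def max_indep_def)
    fix c assume c: "c \<in> V - A"
    then obtain a where "a \<in> A" "adj c a" using A unfolding max_indep_def by blast
    then have "meets_edge adj V {} (insert c A)" using AV c unfolding meets_edge_def by blast
    then have "?u \<in> mono_ideal V (\<lambda>S. meets_edge adj V {} (insert c S))"
      using AV by (simp add: mono_ideal_def polys_def m)
    then show "Var c * ?u \<in> ?I" using c by (simp add: Var_mult_mem_mono_ideal)
  qed (use fin in auto)
  then show "card V - card A \<le> n" using AV fA by (simp add: card_Diff_subset)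
qed

section \<open>The square of a double broom\<close>

definition near :: "('v \<Rightarrow> nat) \<Rightarrow> 'v \<Rightarrow> 'v \<Rightarrow> bool" where
  "near p u w \<longleftrightarrow> u \<noteq> w \<and> p u \<le> p w + 2 \<and> p w \<le> p u + 2"

text \<open>Take \<open>u\<close> leftmost among the non-isolated vertices and \<open>v\<close> as
  its rightmost neighbour: all neighbours of \<open>u\<close> have positions between
  \<open>p u\<close> and \<open>p v\<close>, hence within 2 of \<open>p v\<close>.\<close>

lemma near_dominating_edge:
  assumes "finite W" and "\<exists>u\<in>W. \<exists>w\<in>W. near p u w"
  shows "\<exists>u\<in>W. \<exists>v\<in>W. near p u v \<and> (\<forall>w\<in>W. near p u w \<longrightarrow> w = v \<or> near p v w)"
proof -
  let ?U = "{u \<in> W. \<exists>w\<in>W. near p u w}"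
  have "finite ?U" "?U \<noteq> {}" using assms by auto
  then obtain u where u: "u \<in> ?U" "\<forall>x\<in>?U. p u \<le> p x"
    using arg_min_if_finite[of ?U p] by (metis (no_types, lifting) linorder_not_le)
  let ?N = "{w \<in> W. near p u w}"
  have N: "finite ?N" "?N \<noteq> {}" using u assms by auto
  define m where "m = Max (p ` ?N)"
  have "m \<in> p ` ?N" unfolding m_def using N by (intro Max_in) auto
  then obtain v where v: "v \<in> ?N" "p v = m" by blast
  have max: "p w \<le> p v" if "w \<in> ?N" for w
    unfolding v(2) m_def using N that by (intro Max_ge) auto
  have "w = v \<or> near p v w" if w: "w \<in> W" "near p u w" for w
  proof -
    have "near p w u" using w by (auto simp: near_def)
    then have "w \<in> ?U" using w u by blast
    then have "p u \<le> p w" using u by blast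
    moreover have "p w \<le> p v" "p v \<le> p u + 2" using max w v by (auto simp: near_def)
    ultimately show ?thesis by (auto simp: near_def)
  qed
  then show ?thesis using u v by blast
qed

text \<open>The leaves at the two ends extend the path to \<^term>\<open>k + 2\<close> positions; two vertices are at
  distance at most 2 iff their positions differ by at most 2.\<close>

definition pos :: "nat \<Rightarrow> nat \<Rightarrow> nat \<Rightarrow> nat" where
  "pos n1 k v = (if v < k then v + 1 else if v < k + n1 - 1 then 0 else k + 1)"

lemma double_broom_edge_iff:
  "{u, w} \<in> double_broom_edges n1 k n2 \<longleftrightarrow>
    w = u + 1 \<and> w < k \<or> u = w + 1 \<and> u < k \<or>
    u = 0 \<and> k \<le> w \<and> w < k + n1 - 1 \<or> w = 0 \<and> k \<le> u \<and> u < k + n1 - 1 \<or>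
    u = k - 1 \<and> k + n1 - 1 \<le> w \<and> w < k + n1 + n2 - 2 \<or>
    w = k - 1 \<and> k + n1 - 1 \<le> u \<and> u < k + n1 + n2 - 2"
  unfolding double_broom_edges_def by (simp add: doubleton_eq_iff) blast

lemma graph_square_iff:
  assumes "u \<noteq> w"
  shows "{u, w} \<in> graph_square E \<longleftrightarrow> {u, w} \<in> E \<or> (\<exists>v. {u, v} \<in> E \<and> {v, w} \<in> E)"
proof -
  have "{u, w} \<in> {{u, w} | u v w. u \<noteq> w \<and> {u, v} \<in> E \<and> {v, w} \<in> E} \<longleftrightarrow>
    (\<exists>v. {u, v} \<in> E \<and> {v, w} \<in> E)" (is "?L \<longleftrightarrow> ?R")
  proof
    assume ?L
    then obtain a v b where "{u, w} = {a, b}" "{a, v} \<in> E" "{v, b} \<in> E" by blast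
    then show ?R by (auto simp: doubleton_eq_iff insert_commute)
  qed (use assms in blast)
  then show ?thesis unfolding graph_square_def by blast
qed

lemma double_broom_edge_pos:
  assumes "n1 \<ge> 2" "n2 \<ge> 2" "k \<ge> 2" and "{u, w} \<in> double_broom_edges n1 k n2"
  shows "u \<in> double_broom_vertices n1 k n2 \<and> w \<in> double_broom_vertices n1 k n2 \<and>
    pos n1 k u \<le> pos n1 k w + 1 \<and> pos n1 k w \<le> pos n1 k u + 1"
  using assms(4)[unfolded double_broom_edge_iff]
  by (elim disjE) (use assms(1-3) in \<open>auto simp: double_broom_vertices_def pos_def\<close>)

lemma double_broom_vertex_cases:
  assumes "u \<in> double_broom_vertices n1 k n2"
  obtains "u < k" "pos n1 k u = u + 1"
  | "k \<le> u" "u < k + n1 - 1" "pos n1 k u = 0"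
  | "k \<le> u" "k + n1 - 1 \<le> u" "u < k + n1 + n2 - 2" "pos n1 k u = k + 1"
proof -
  have "u < k + n1 + n2 - 2" using assms by (simp add: double_broom_vertices_def)
  then show thesis
    using that by (cases "u < k"; cases "u < k + n1 - 1") (simp_all add: pos_def)
qed

text \<open>Along an edge the position changes by at most one, which gives one direction.
  Conversely, vertices at most two positions apart are joined by an edge or through an explicit
  common neighbour.\<close>

lemma double_broom_square_iff:
  assumes n: "n1 \<ge> 2" "n2 \<ge> 2" "k \<ge> 2" and uw: "u \<noteq> w"
  shows "{u, w} \<in> graph_square (double_broom_edges n1 k n2) \<longleftrightarrow>
    u \<in> double_broom_vertices n1 k n2 \<and> w \<in> double_broom_vertices n1 k n2 \<and> near (pos n1 k) u w"
    (is "?L \<longleftrightarrow> ?R")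
proof
  assume ?L
  then have "{u, w} \<in> double_broom_edges n1 k n2 \<or>
      (\<exists>v. {u, v} \<in> double_broom_edges n1 k n2 \<and> {v, w} \<in> double_broom_edges n1 k n2)"
    by (simp only: graph_square_iff[OF uw])
  then show ?R
  proof (elim disjE exE conjE)
    assume "{u, w} \<in> double_broom_edges n1 k n2"
    then show ?R using double_broom_edge_pos[OF n] uw unfolding near_def by fastforce
  next
    fix v assume "{u, v} \<in> double_broom_edges n1 k n2" "{v, w} \<in> double_broom_edges n1 k n2"
    from this[THEN double_broom_edge_pos[OF n]] show ?R using uw unfolding near_def by linarith
  qed
next
  have *: "{u, w} \<in> graph_square (double_broom_edges n1 k n2)"
    if u: "u \<in> double_broom_vertices n1 k n2" and w: "w \<in> double_broom_vertices n1 k n2"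
      and near: "near (pos n1 k) u w" and le: "pos n1 k u \<le> pos n1 k w" for u w
  proof -
    have uw: "u \<noteq> w" "pos n1 k w \<le> pos n1 k u + 2" using near by (auto simp: near_def)
    \<comment> \<open>The middle vertex: the path end that carries the leaf if \<open>u\<close> is a
      left or \<open>w\<close> a right leaf, otherwise the path vertex after
      \<open>u\<close>.\<close>
    define v where "v = (if pos n1 k u = 0 then 0 else if pos n1 k w = k + 1 then k - 1 else u + 1)"
    have "{u, w} \<in> double_broom_edges n1 k n2 \<or>
      {u, v} \<in> double_broom_edges n1 k n2 \<and> {v, w} \<in> double_broom_edges n1 k n2"
      (is "?A \<or> ?B")
    proof (cases rule: double_broom_vertex_cases[OF u])
      case u1: 1
      show ?thesis
      proof (cases rule: double_broom_vertex_cases[OF w])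
        case 1
        then have "w = u + 1 \<or> w = u + 2" "v = u + 1" using u1 uw le by (auto simp: v_def)
        then show ?thesis
        proof (elim disjE)
          assume "w = u + 1"
          then have ?A using 1 by (simp add: double_broom_edge_iff)
          then show ?thesis ..
        next
          assume "w = u + 2" "v = u + 1"
          then have ?B using 1 by (simp add: double_broom_edge_iff)
          then show ?thesis ..
        qed
      next
        case 2
        then show ?thesis using u1 le by simp
      next
        case 3
        then have "u = k - 1 \<or> u + 1 = k - 1" "v = k - 1" using u1 uw by (auto simp: v_def)
        then show ?thesis
        proof (elim disjE)
          assume "u = k - 1"
          then have ?A using 3 by (simp add: double_broom_edge_iff)
          then show ?thesis ..
        next
          assume "u + 1 = k - 1" "v = k - 1"
          then have ?B using 3 n by (simp add: double_broom_edge_iff)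
          then show ?thesis ..
        qed
      qed
    next
      case u2: 2
      then have v: "v = 0" by (simp add: v_def)
      then have uv: "{u, v} \<in> double_broom_edges n1 k n2" using u2 by (simp add: double_broom_edge_iff)
      show ?thesis
      proof (cases rule: double_broom_vertex_cases[OF w])
        case 1
        then have "w = 0 \<or> w = 1" using u2 uw by auto
        then show ?thesis
        proof
          assume "w = 0"
          then show ?thesis using uv v by simp
        next
          assume "w = 1"
          then have "{v, w} \<in> double_broom_edges n1 k n2"
            using v n by (simp add: double_broom_edge_iff)
          then show ?thesis using uv by simp
        qed
      next
        case 2
        then have "{v, w} \<in> double_broom_edges n1 k n2" using v by (simp add: double_broom_edge_iff)
        then show ?thesis using uv by simp
      next
        case 3
        \<comment> \<open>Leaves at opposite ends differ by \<open>k + 1\<close> positions, which is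
          at least 3.\<close>
        then show ?thesis using u2 uw n by simp
      qed
    next
      case u3: 3
      show ?thesis
      proof (cases rule: double_broom_vertex_cases[OF w])
        case 3
        then have "v = k - 1" using u3 n by (simp add: v_def)
        then have "{u, v} \<in> double_broom_edges n1 k n2" "{v, w} \<in> double_broom_edges n1 k n2"
          using u3 3 by (simp_all add: double_broom_edge_iff)
        then show ?thesis by simp
      qed (use u3 le in auto)
    qed
    then show ?thesis using graph_square_iff[OF uw(1)] by blast
  qed
  assume ?R
  then have "near (pos n1 k) w u" by (auto simp: near_def)
  then show ?L using *[of u w] *[of w u] \<open>?R\<close> by (metis insert_commute linear)
qed

section \<open>Sizes of maximal independent sets in the squared broom\<close>

text \<open>A maximal independent set dominates all \<open>k + 2\<close> positions and each member
  at most 5 of them; \<open>(k + 6) div 5\<close> is the ceiling of (k + 2)/5.\<close>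

lemma double_broom_max_indep_card:
  assumes n: "n1 \<ge> 2" "n2 \<ge> 2" "k \<ge> 2"
    and B: "max_indep (near (pos n1 k)) (double_broom_vertices n1 k n2) B"
  shows "(k + 6) div 5 \<le> card B"
proof -
  let ?V = "double_broom_vertices n1 k n2"
  have finB: "finite B"
    using B by (auto simp: max_indep_def double_broom_vertices_def intro: finite_subset)
  have "\<exists>b\<in>B. t \<in> {pos n1 k b - 2..pos n1 k b + 2}" if t: "t < k + 2" for t
  proof -
    \<comment> \<open>A vertex at position \<open>t\<close>: the first left leaf, a path vertex or
      the first right leaf. Both leaves exist because \<open>n1\<close> and \<open>n2\<close> are at
      least 2.\<close>
    define w where "w = (if t = 0 then k else if t \<le> k then t - 1 else k + n1 - 1)"
    have w: "w \<in> ?V" "pos n1 k w = t"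
      using n t by (auto simp: w_def double_broom_vertices_def pos_def)
    show ?thesis
    proof (cases "w \<in> B")
      case True
      then show ?thesis using w by force
    next
      case False
      then obtain b where b: "b \<in> B" "near (pos n1 k) w b" using B w unfolding max_indep_def by blast
      then show ?thesis using w(2) by (intro bexI[of _ b]) (auto simp: near_def)
    qed
  qed
  then have "{..<k + 2} \<subseteq> (\<Union>b\<in>B. {pos n1 k b - 2..pos n1 k b + 2})" by blast
  then have "card {..<k + 2} \<le> card (\<Union>b\<in>B. {pos n1 k b - 2..pos n1 k b + 2})"
    using finB by (intro card_mono) auto
  also have "\<dots> \<le> (\<Sum>b\<in>B. card {pos n1 k b - 2..pos n1 k b + 2})" by (rule card_UN_le[OF finB])
  also have "\<dots> \<le> (\<Sum>b\<in>B. 5)" by (intro sum_mono) auto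
  finally show ?thesis by simp
qed

text \<open>Every fifth position 2, 7, 12, ... is taken, the last one being moved back to
  \<open>k + 1\<close> if it lies beyond the end.\<close>

lemma double_broom_max_indep_exists:
  assumes n: "n1 \<ge> 2" "n2 \<ge> 2" "k \<ge> 2"
  obtains A where "max_indep (near (pos n1 k)) (double_broom_vertices n1 k n2) A"
    "card A = (k + 6) div 5"
proof
  let ?V = "double_broom_vertices n1 k n2"
  define c where "c = (k + 6) div 5"
  define q where "q j = min (5 * j + 2) (k + 1)" for j
  define f where "f j = (if q j \<le> k then q j - 1 else k + n1 - 1)" for j
  have pos_f: "pos n1 k (f j) = q j" and f_V: "f j \<in> ?V" for j
    using n by (auto simp: f_def q_def pos_def double_broom_vertices_def)
  \<comment> \<open>For the cut-off position, \<open>i \<le> c - 2\<close> and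
    \<open>5 * c \<le> k + 6\<close> give \<open>5 * i + 5 \<le> k + 1\<close>.\<close>
  have gap: "q i + 3 \<le> q j" if "i < j" "j < c" for i j
    using that unfolding q_def c_def by linarith
  have "i = j" if "i < c" "j < c" "q i \<le> q j + 2" "q j \<le> q i + 2" for i j
    using gap[of i j] gap[of j i] that by (cases i j rule: linorder_cases) auto
  then have sep: "i = j" if "i < c" "j < c" "pos n1 k (f i) \<le> pos n1 k (f j) + 2"
    "pos n1 k (f j) \<le> pos n1 k (f i) + 2" for i j using that by (simp add: pos_f)
  have "inj_on f {..<c}" by (rule inj_onI) (use sep in auto)
  then show "card (f ` {..<c}) = (k + 6) div 5" by (simp add: card_image c_def)
  have "\<exists>a\<in>f ` {..<c}. near (pos n1 k) w a" if w: "w \<in> ?V" "w \<notin> f ` {..<c}" for w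
  proof -
    let ?t = "pos n1 k w"
    have t: "?t \<le> k + 1" by (simp add: pos_def)
    have j: "?t div 5 < c" using t unfolding c_def by linarith
    \<comment> \<open>The block of five positions containing \<open>?t\<close> is centred at the
      chosen one; the cut-off can only move that centre closer to \<open>?t\<close>.\<close>
    have "q (?t div 5) \<le> ?t + 2" "?t \<le> q (?t div 5) + 2" using t unfolding q_def by linarith+
    then have "near (pos n1 k) w (f (?t div 5))"
      using w j unfolding near_def pos_f by auto
    then show ?thesis using j by blast
  qed
  moreover have "\<not> near (pos n1 k) a b" if "a \<in> f ` {..<c}" "b \<in> f ` {..<c}" for a b
    using that sep by (auto simp: near_def)
  ultimately show "max_indep (near (pos n1 k)) ?V (f ` {..<c})"
    unfolding max_indep_def using f_V by blast
qed

theorem theorem4p13: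
  fixes n1 n2 k :: nat
  assumes "n1 \<ge> 2" and "n2 \<ge> 2" and "k \<ge> 2"
  defines "n \<equiv> n1 + n2 + k - 2"
  shows "int (projdim_quot (double_broom_vertices n1 k n2)
           (edge_ideal (double_broom_vertices n1 k n2)
              (graph_square (double_broom_edges n1 k n2)) :: (nat, 'k::field) mpoly set))
         = (if k \<in> {2, 3} then int n - 1
            else if k \<le> 8 then int n - 2
            else int n - 2 - \<lceil>(real k - 8) / 5\<rceil>)"
proof -
  let ?V = "double_broom_vertices n1 k n2" and ?E = "graph_square (double_broom_edges n1 k n2)"
  let ?adj = "near (pos n1 k)"
  note sq = double_broom_square_iff[OF assms(1-3)]
  obtain A where A: "max_indep ?adj ?V A" "card A = (k + 6) div 5"
    by (rule double_broom_max_indep_exists[OF assms(1-3)])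
  have fin: "finite ?V" and card: "card ?V = n"
    by (simp_all add: double_broom_vertices_def n_def)
  have "(\<lambda>S. \<exists>u v. u \<noteq> v \<and> {u, v} \<in> ?E \<and> u \<in> S \<and> v \<in> S) = meets_edge ?adj ?V {}"
  proof (intro ext iffI)
    fix S assume "\<exists>u v. u \<noteq> v \<and> {u, v} \<in> ?E \<and> u \<in> S \<and> v \<in> S"
    then show "meets_edge ?adj ?V {} S" using sq unfolding meets_edge_def by blast
  next
    fix S assume "meets_edge ?adj ?V {} S"
    then obtain u w where "u \<in> ?V \<inter> S" "w \<in> ?V \<inter> S" "?adj u w"
      unfolding meets_edge_def by blast
    moreover from this have "u \<noteq> w" by (simp add: near_def)
    ultimately show "\<exists>u v. u \<noteq> v \<and> {u, v} \<in> ?E \<and> u \<in> S \<and> v \<in> S" using sq by blast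
  qed
  then have "(edge_ideal ?V ?E :: (nat, 'k) mpoly set) = mono_ideal ?V (meets_edge ?adj ?V {})"
    using sq by (subst edge_ideal_eq_mono_ideal) auto
  moreover have "projdim_quot ?V (mono_ideal ?V (meets_edge ?adj ?V {}) :: (nat, 'k) mpoly set)
    = card ?V - card A"
  proof (rule projdim_edge_ideal[OF _ _ _ fin A(1)])
    show "card A \<le> card B" if "max_indep ?adj ?V B" for B
      unfolding A(2) by (rule double_broom_max_indep_card[OF assms(1-3) that])
    show "\<exists>u\<in>W. \<exists>v\<in>W. ?adj u v \<and> (\<forall>w\<in>W. ?adj u w \<longrightarrow> w = v \<or> ?adj v w)"
      if "W \<subseteq> ?V" "\<exists>u\<in>W. \<exists>w\<in>W. ?adj u w" for W
      using near_dominating_edge[OF finite_subset[OF that(1) fin] that(2)] .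
  qed (auto simp: near_def)
  \<comment> \<open>Ensures that the natural subtraction carries over to the integers.\<close>
  moreover have "card A \<le> card ?V"
    using A(1) fin by (intro card_mono) (auto simp: max_indep_def)
  ultimately have "int (projdim_quot ?V (edge_ideal ?V ?E :: (nat, 'k) mpoly set))
    = int n - int ((k + 6) div 5)"
    by (simp add: card A(2) of_nat_diff)
  moreover have "int ((k + 6) div 5) = (if k \<in> {2, 3} then 1 else if k \<le> 8 then 2
      else 2 + \<lceil>(real k - 8) / 5\<rceil>)"
  proof (cases "k \<le> 8")
    case True
    then have "k = 2 \<or> k = 3 \<or> k = 4 \<or> k = 5 \<or> k = 6 \<or> k = 7 \<or> k = 8" using assms(3) by linarith
    then show ?thesis by auto
  next
    case False
    define c where "c = (k + 6) div 5"
    \<comment> \<open>These bounds say that \<open>c\<close> is the ceiling of (k + 2)/5, which is 2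
      more than that of (k - 8)/5.\<close>
    have "5 * c \<le> k + 6" "k + 2 \<le> 5 * c" unfolding c_def by linarith+
    then have "real (5 * c) \<le> real (k + 6)" "real (k + 2) \<le> real (5 * c)" by (simp_all only: of_nat_le_iff)
    then have "real_of_int (int c - 2) - 1 < (real k - 8) / 5" "(real k - 8) / 5 \<le> real_of_int (int c - 2)"
      by (simp_all add: field_simps)
    then have "\<lceil>(real k - 8) / 5\<rceil> = int c - 2" by (rule ceiling_unique)
    then show ?thesis using False by (auto simp: c_def)
  qed
  ultimately show ?thesis by auto
qed

end
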